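(* Let $0<a_1<a_2<l$ and $\mathbb{T}=[0,a_1]\cup[a_2,l]$. Let $q,\widetilde q$ be real-valued continuous functions on $\mathbb{T}$ and $h,H\in\mathbb{R}$. Consider the boundary value problems $L$ and $\widetilde L$: $$-y^{\Delta\Delta}(t)+q(t)y^{\sigma}(t)=\lambda y^{\sigma}(t),\quad t\in\mathbb{T}^{\kappa^2},\qquad y^{\Delta}(0)-hy(0)=0,\qquad y^{\Delta}(l)+Hy(l)=0,$$ and the same problem with $q$ replaced by $\widetilde q$ (same $h,H$). Let $\Lambda=\{\lambda_n\}_{n\ge1}$ and $\widetilde\Lambda=\{\widetilde\lambda_n\}_{n\ge1}$ be the sets of eigenvalues of $L$ and $\widetilde L$, respectively. Let $\varphi(t,\lambda)$ (resp. $\widetilde\varphi(t,\lambda)$) be the solution of the equation of $L$ (resp. $\widetilde L$) satisfying $\varphi(0,\lambda)=1$, $\varphi^{\Delta}(0,\lambda)=h$ (resp. $\widetilde\varphi(0,\lambda)=1$, $\widetilde\varphi^{\Delta}(0,\lambda)=h$). If $\Lambda=\widetilde\Lambda$, $a_1+a_2=l$, and for all $n\ge1$ $$\frac{\varphi^{\Delta}(a_1,\lambda_n)}{\varphi(a_1,\lambda_n)}=\frac{\widetilde\varphi^{\Delta}(a_1,\lambda_n)}{\widetilde\varphi(a_1,\lambda_n)},$$ then $q(t)=\widetilde q(t)$ on $\mathbb{T}$.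
   Context: $\mathbb{T}$ is a time scale (closed subset of $\mathbb{R}$); $\sigma(t)=\inf\{s\in\mathbb{T}:s>t\}$ is the forward jump operator, $y^{\sigma}=y\circ\sigma$, $y^{\Delta}$ denotes the delta (Hilger) derivative, and $\mathbb{T}^{\kappa^2}$ is $\mathbb{T}$ with the appropriate right-endpoint points removed so that $y^{\Delta\Delta}$ is defined. A solution is a function $y\in C^2_{rd}(\mathbb{T})$ satisfying the equation; $\lambda$ is an eigenvalue if the boundary value problem has a nonzero solution. The eigenvalues are real, simple, countably many and bounded below, ordered increasingly $\lambda_1<\lambda_2<\cdots$; the functions $\varphi(t,\cdot)$, $\varphi^{\Delta}(t,\cdot)$ are entire in $\lambda$. *)

theory Defs
  imports "HOL-Analysis.Analysis"
begin

definition tsigma :: "real set \<Rightarrow> real \<Rightarrow> real" where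
  "tsigma T t = (if \<exists>s\<in>T. t < s then Inf {s\<in>T. t < s} else t)"

definition trho :: "real set \<Rightarrow> real \<Rightarrow> real" where
  "trho T t = (if \<exists>s\<in>T. s < t then Sup {s\<in>T. s < t} else t)"

definition tkappa :: "real set \<Rightarrow> real set" where
  "tkappa T = {t\<in>T. \<not> ((\<forall>s\<in>T. s \<le> t) \<and> trho T t < t)}"

definition has_delta_derivative :: "real set \<Rightarrow> (real \<Rightarrow> real) \<Rightarrow> real \<Rightarrow> real \<Rightarrow> bool" where
  "has_delta_derivative T f D t \<longleftrightarrow>
     (\<forall>\<epsilon>>0. \<exists>\<delta>>0. \<forall>s\<in>T. \<bar>s - t\<bar> < \<delta> \<longrightarrow>
        \<bar>f (tsigma T t) - f s - D * (tsigma T t - s)\<bar> \<le> \<epsilon> * \<bar>tsigma T t - s\<bar>)"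

definition delta_deriv :: "real set \<Rightarrow> (real \<Rightarrow> real) \<Rightarrow> real \<Rightarrow> real" where
  "delta_deriv T f t = (THE D. has_delta_derivative T f D t)"

definition rd_continuous :: "real set \<Rightarrow> (real \<Rightarrow> real) \<Rightarrow> bool" where
  "rd_continuous T f \<longleftrightarrow>
     (\<forall>t\<in>T. tsigma T t = t \<longrightarrow> continuous (at t within T) f) \<and>
     (\<forall>t\<in>T. trho T t = t \<longrightarrow> (\<exists>L. (f \<longlongrightarrow> L) (at t within {s\<in>T. s < t})))"

definition C2rd :: "real set \<Rightarrow> (real \<Rightarrow> real) \<Rightarrow> bool" where
  "C2rd T y \<longleftrightarrow>
     (\<forall>t\<in>tkappa T. \<exists>D. has_delta_derivative T y D t) \<and>
     (\<forall>t\<in>tkappa (tkappa T). \<exists>D. has_delta_derivative (tkappa T) (delta_deriv T y) D t) \<and>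
     rd_continuous (tkappa (tkappa T)) (delta_deriv (tkappa T) (delta_deriv T y))"

definition solves_SL :: "real set \<Rightarrow> (real \<Rightarrow> real) \<Rightarrow> real \<Rightarrow> (real \<Rightarrow> real) \<Rightarrow> bool" where
  "solves_SL T q lam y \<longleftrightarrow> C2rd T y \<and>
     (\<forall>t\<in>tkappa (tkappa T).
        - delta_deriv (tkappa T) (delta_deriv T y) t + q t * y (tsigma T t)
          = lam * y (tsigma T t))"

definition is_eigenvalue :: "real set \<Rightarrow> real \<Rightarrow> (real \<Rightarrow> real) \<Rightarrow> real \<Rightarrow> real \<Rightarrow> real \<Rightarrow> bool" where
  "is_eigenvalue T l q h H lam \<longleftrightarrow>
     (\<exists>y. solves_SL T q lam y \<and>
          delta_deriv T y 0 - h * y 0 = 0 \<and>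
          delta_deriv T y l + H * y l = 0 \<and>
          (\<exists>t\<in>T. y t \<noteq> 0))"

end

theory Submission
  imports Defs "HOL-Complex_Analysis.Complex_Analysis"
begin

text \<open>On each of the two intervals the equation is a classical Sturm--Liouville equation, and at the
  scattered point \<open>a1\<close> it becomes a jump condition for \<open>(y, y')\<close>. Hence the eigenvalues are the zeros
  of an entire function \<open>\<Delta>\<close>, built from the solution \<open>Y\<close> on \<open>[0, a1]\<close> started at \<open>0\<close> and the solution
  \<open>Z\<close> on \<open>[a2, l]\<close> started at \<open>l\<close>. A Herglotz argument shows that these zeros are real and simple.

  The entire function \<open>Y' Yt - Yt' Y\<close> (at \<open>a1\<close>, with \<open>Yt\<close> the solution for the second potential)
  vanishes at every eigenvalue, so its quotient by \<open>\<Delta>\<close> is entire. As \<open>a1 + a2 = l\<close>, both functions have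
  exponential type \<open>2 a1\<close> in \<open>\<rho> = sqrt \<lambda>\<close>, but \<open>\<Delta>\<close> gains powers of \<open>\<rho>\<close> from the gap; by the maximum
  principle on large squares the quotient is \<open>0\<close>. So the two Weyl functions on \<open>[0, a1]\<close> coincide and
  Borg's theorem gives equality of the potentials there. At an eigenvalue the data of \<open>Z\<close> at \<open>a2\<close> are
  then proportional to those of \<open>Zt\<close>, and the same argument applies to \<open>[a2, l]\<close>.\<close>

section \<open>Linear second-order equations\<close>

text \<open>The gap is what makes the quotient decay. The numerator contains one derivative, so it
  is O(|rho| exp (2 a1 |Im rho|)). Crossing the gap brings in \<open>d\<close> times a derivative
  and then \<open>d\<close> times \<open>\<mu>\<close>, which lifts \<Delta> to order |rho|^3 on
  suitable squares; without the gap both functions would have order |rho| and the quotient would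
  merely be bounded. The exponential type of \<Delta> is a1 + (l - a2), against 2 a1 for the
  numerator of the left step and 2 (l - a2) for that of the right step, so
  \<open>a1 + a2 = l\<close> balances both. The data live on real eigenvalues and give vanishing of
  first order only. Hence nonreal and multiple zeros of \<Delta> have to be excluded before
  dividing; one quantitative bound, |\<Delta>| at least a constant times |Im \<mu>| on bounded sets,
  excludes both. Logarithmic derivatives are compared as cross products because the solutions may
  vanish at \<open>a1\<close>.\<close>

definition ode_sol ::
  "real \<Rightarrow> (real \<Rightarrow> complex) \<Rightarrow> (real \<Rightarrow> complex) \<Rightarrow> (real \<Rightarrow> complex) \<Rightarrow> bool" where
  "ode_sol a p y y' \<longleftrightarrow> (\<forall>x\<in>{0..a}.
     (y has_vector_derivative y' x) (at x within {0..a}) \<and>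
     (y' has_vector_derivative p x * y x) (at x within {0..a}))"

lemma ode_sol_continuous:
  assumes "ode_sol a p y y'"
  shows "continuous_on {0..a} y" "continuous_on {0..a} y'"
  using assms unfolding ode_sol_def
  by (auto intro!: continuous_on_vector_derivative)

lemma ode_sol_cong:
  assumes "ode_sol a p y y'" "\<And>x. x \<in> {0..a} \<Longrightarrow> p x = p' x"
  shows "ode_sol a p' y y'"
  using assms unfolding ode_sol_def by auto

lemma ode_sol_combine:
  assumes "ode_sol a p y y'" "ode_sol a p z z'"
  shows "ode_sol a p (\<lambda>x. b * y x + c * z x) (\<lambda>x. b * y' x + c * z' x)"
  using assms unfolding ode_sol_def
  by (auto intro!: derivative_eq_intros simp: algebra_simps)

text \<open>Families always start at \<open>0\<close>; reflection turns data at the right end into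
  initial data, with a sign on the derivative.\<close>

lemma ode_sol_reflect:
  assumes "ode_sol a p y y'"
  shows "ode_sol a (\<lambda>x. p (a - x)) (\<lambda>x. y (a - x)) (\<lambda>x. - y' (a - x))"
proof -
  have refl: "((\<lambda>x. f (a - x)) has_vector_derivative - f') (at x within {0..a})"
    if "(f has_vector_derivative f') (at (a - x) within {0..a})" "x \<in> {0..a}"
    for f :: "real \<Rightarrow> complex" and f' x
  proof -
    have "(f has_vector_derivative f') (at (a - x) within (\<lambda>x. a - x) ` {0..a})"
      using that by (auto intro: has_vector_derivative_within_subset)
    moreover have "((\<lambda>x. a - x) has_vector_derivative - 1) (at x within {0..a})"
      by (auto intro!: derivative_eq_intros)
    ultimately have "((f \<circ> (\<lambda>x. a - x)) has_vector_derivative (-1) *\<^sub>R f') (at x within {0..a})"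
      by (intro vector_diff_chain_within)
    then show ?thesis by (simp add: o_def)
  qed
  have "((\<lambda>x. y (a - x)) has_vector_derivative - y' (a - x)) (at x within {0..a})"
    and "((\<lambda>x. - y' (a - x)) has_vector_derivative p (a - x) * y (a - x)) (at x within {0..a})"
    if "x \<in> {0..a}" for x
    using assms that refl[of y "y' (a - x)" x]
      has_vector_derivative_minus[OF refl[of y' "p (a - x) * y (a - x)" x]]
    unfolding ode_sol_def by auto
  then show ?thesis unfolding ode_sol_def by blast
qed

text \<open>In the derivative of \<open>y' * z - y * z'\<close> the products of first derivatives
  cancel. Different choices of the second equation turn this identity into constancy of Wronskians,
  holomorphy in the parameter, Duhamel's formula and the Herglotz property.\<close>

lemma ode_sol_lagrange:
  assumes y: "ode_sol a p y y'" and z: "ode_sol a p' z z'" and x: "x \<in> {0..a}"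
  shows "((\<lambda>t. (p t - p' t) * (y t * z t)) has_integral
           (y' x * z x - y x * z' x) - (y' 0 * z 0 - y 0 * z' 0)) {0..x}"
proof (rule fundamental_theorem_of_calculus)
  fix t assume t: "t \<in> {0..x}"
  have "((\<lambda>t. y' t * z t - y t * z' t) has_vector_derivative
          (p t - p' t) * (y t * z t)) (at t within {0..a})"
    using y z t x unfolding ode_sol_def
    by (auto intro!: derivative_eq_intros simp: algebra_simps)
  then show "((\<lambda>t. y' t * z t - y t * z' t) has_vector_derivative
          (p t - p' t) * (y t * z t)) (at t within {0..x})"
    by (rule has_vector_derivative_within_subset) (use x in auto)
qed (use x in auto)

lemma ode_sol_wronskian:
  assumes "ode_sol a p y y'" "ode_sol a p z z'" "x \<in> {0..a}"
  shows "y' x * z x - y x * z' x = y' 0 * z 0 - y 0 * z' 0"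
proof -
  have "((\<lambda>t. 0) has_integral (y' x * z x - y x * z' x) - (y' 0 * z 0 - y 0 * z' 0)) {0..x}"
    using ode_sol_lagrange[OF assms] by simp
  then show ?thesis by (metis eq_iff_diff_eq_0 has_integral_0_eq)
qed

section \<open>Existence by Picard iteration, uniqueness by Wronskians\<close>

lemma has_vector_derivative_series:
  fixes f :: "nat \<Rightarrow> real \<Rightarrow> 'b::banach"
  assumes "convex S"
    and deriv: "\<And>n x. x \<in> S \<Longrightarrow> (f n has_vector_derivative f' n x) (at x within S)"
    and lim: "uniform_limit S (\<lambda>n x. \<Sum>i<n. f' i x) g' sequentially"
    and sums: "\<And>x. x \<in> S \<Longrightarrow> (\<lambda>n. f n x) sums g x"
    and x: "x \<in> S"
  shows "(g has_vector_derivative g' x) (at x within S)"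
proof -
  have "\<exists>G. \<forall>x\<in>S. (\<lambda>n. f n x) sums (G x) \<and> (G has_derivative (\<lambda>h. h *\<^sub>R g' x)) (at x within S)"
  proof (rule has_derivative_series[where f = f, OF \<open>convex S\<close>])
    show "x \<in> S" "(\<lambda>n. f n x) sums g x" by (fact x, rule sums[OF x])
    show "(f n has_derivative (\<lambda>h. h *\<^sub>R f' n x)) (at x within S)" if "x \<in> S" for n x
      using deriv[OF that] by (simp add: has_vector_derivative_def)
    fix e :: real assume "e > 0"
    then have "\<forall>\<^sub>F n in sequentially. \<forall>x\<in>S. norm ((\<Sum>i<n. f' i x) - g' x) < e"
      using lim by (simp add: uniform_limit_iff dist_norm)
    then show "\<forall>\<^sub>F n in sequentially. \<forall>x\<in>S. \<forall>h.
        norm ((\<Sum>i<n. h *\<^sub>R f' i x) - h *\<^sub>R g' x) \<le> e * norm h"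
    proof eventually_elim
      case (elim n)
      have "norm ((\<Sum>i<n. h *\<^sub>R f' i x) - h *\<^sub>R g' x) \<le> e * norm h" if "x \<in> S" for x h
      proof -
        have "norm ((\<Sum>i<n. h *\<^sub>R f' i x) - h *\<^sub>R g' x) = norm h * norm ((\<Sum>i<n. f' i x) - g' x)"
          by (simp add: scaleR_right.sum [symmetric] scaleR_diff_right [symmetric])
        also have "\<dots> \<le> norm h * e"
          using elim that by (intro mult_left_mono) (auto intro: less_imp_le)
        finally show ?thesis by (simp add: mult.commute)
      qed
      then show ?case by blast
    qed
  qed
  then obtain G where G: "\<And>x. x \<in> S \<Longrightarrow> (\<lambda>n. f n x) sums (G x)"
      "\<And>x. x \<in> S \<Longrightarrow> (G has_vector_derivative g' x) (at x within S)"
    unfolding has_vector_derivative_def by blast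
  have "G t = g t" if "t \<in> S" for t
    using G(1)[OF that] sums[OF that] by (rule sums_unique2)
  then show ?thesis
    using has_vector_derivative_transform[OF x _ G(2)[OF x], of g] by simp
qed

text \<open>Picard iteration with explicit constants. The final bound sees \<open>p\<close> only
  through \<open>Q\<close>, which later makes it uniform for bounded spectral parameters.\<close>

lemma ode_sol_exists:
  fixes p :: "real \<Rightarrow> complex"
  assumes "0 \<le> a" and p: "continuous_on {0..a} p" and Q: "\<And>x. x \<in> {0..a} \<Longrightarrow> norm (p x) \<le> Q"
  obtains y y' where "ode_sol a p y y'" "y 0 = \<alpha>" "y' 0 = \<beta>"
    "\<And>x. x \<in> {0..a} \<Longrightarrow> norm (y x) \<le> (norm \<alpha> + norm \<beta> * a) * exp (Q * a\<^sup>2)"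
proof -
  \<comment> \<open>These are the Picard corrections, not the iterates: the solution is the sum of
    all \<open>u n\<close>, and \<open>v n\<close>, \<open>w n\<close> are the first and second
    derivatives of \<open>u n\<close>.\<close>
  define u :: "nat \<Rightarrow> real \<Rightarrow> complex" where
    "u = rec_nat (\<lambda>x. \<alpha> + \<beta> * of_real x)
           (\<lambda>_ f x. integral {0..x} (\<lambda>s. integral {0..s} (\<lambda>t. p t * f t)))"
  define v :: "nat \<Rightarrow> real \<Rightarrow> complex" where
    "v n x = (case n of 0 \<Rightarrow> \<beta> | Suc m \<Rightarrow> integral {0..x} (\<lambda>t. p t * u m t))" for n x
  define w :: "nat \<Rightarrow> real \<Rightarrow> complex" where
    "w n x = (case n of 0 \<Rightarrow> 0 | Suc m \<Rightarrow> p x * u m x)" for n x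
  define K where "K = norm \<alpha> + norm \<beta> * a"
  have Q0: "0 \<le> Q" using Q[of 0] \<open>0 \<le> a\<close> order_trans[OF norm_ge_zero[of "p 0"]] by auto
  have K0: "0 \<le> K" using \<open>0 \<le> a\<close> by (simp add: K_def)
  have u0: "u 0 x = \<alpha> + \<beta> * of_real x" for x by (simp add: u_def)
  have uS: "u (Suc n) x = integral {0..x} (v (Suc n))" for n x
    by (simp add: u_def v_def [abs_def])
  have vS: "v (Suc n) x = integral {0..x} (w (Suc n))" for n x
    by (simp add: v_def w_def [abs_def])
  have v_cont: "continuous_on {0..a} (v (Suc n))" if "continuous_on {0..a} (u n)" for n
  proof -
    have "continuous_on {0..a} (\<lambda>t. p t * u n t)" by (intro continuous_intros p that)
    then show ?thesis
      using indefinite_integral_continuous_1[OF integrable_continuous_real] by (simp add: v_def)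
  qed
  have u_cont: "continuous_on {0..a} (u n)" for n
  proof (induction n)
    case 0 show ?case unfolding u0 by (intro continuous_intros)
  next
    case (Suc n)
    then show ?case
      using indefinite_integral_continuous_1[OF integrable_continuous_real[OF v_cont[OF Suc]]]
      by (simp add: uS [abs_def])
  qed
  have w_cont: "continuous_on {0..a} (w (Suc n))" for n
    unfolding w_def by (auto intro!: continuous_intros p u_cont)
  have u_deriv: "(u n has_vector_derivative v n x) (at x within {0..a})" if "x \<in> {0..a}" for n x
  proof (cases n)
    case 0
    then show ?thesis unfolding 0 u0 v_def by (auto intro!: derivative_eq_intros)
  next
    case (Suc m)
    show ?thesis unfolding Suc uS
      by (rule integral_has_vector_derivative[OF v_cont[OF u_cont] that])
  qed
  have v_deriv: "(v n has_vector_derivative w n x) (at x within {0..a})" if "x \<in> {0..a}" for n x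
  proof (cases n)
    case 0
    then show ?thesis unfolding 0 v_def w_def by simp
  next
    case (Suc m)
    show ?thesis unfolding Suc vS
      by (rule integral_has_vector_derivative[OF w_cont that])
  qed
  \<comment> \<open>The first of the two integrations produces the new factorial. The second is
    bounded crudely by the factor \<open>a\<close>, since a single factorial already gives an
    exponential series.\<close>
  have v_bound: "norm (v (Suc n) x) \<le> Q * K * (Q * a) ^ n * x ^ Suc n / fact (Suc n)"
    if IH: "\<And>t. t \<in> {0..a} \<Longrightarrow> norm (u n t) \<le> K * (Q * a * t) ^ n / fact n"
      and x: "x \<in> {0..a}" for n x
  proof -
    have int: "((\<lambda>t. Q * (K * (Q * a * t) ^ n / fact n)) has_integral
            Q * K * (Q * a) ^ n * x ^ Suc n / fact (Suc n)
            - Q * K * (Q * a) ^ n * 0 ^ Suc n / fact (Suc n)) {0..x}"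
    proof (rule fundamental_theorem_of_calculus)
      fix t assume "t \<in> {0..x}"
      have "((\<lambda>t. Q * K * (Q * a) ^ n * t ^ Suc n / fact (Suc n)) has_real_derivative
              Q * (K * (Q * a * t) ^ n / fact n)) (at t within {0..x})"
        by (rule derivative_eq_intros refl | simp)+
           (simp add: field_simps power_mult_distrib del: of_nat_Suc)
      then show "((\<lambda>t. Q * K * (Q * a) ^ n * t ^ Suc n / fact (Suc n)) has_vector_derivative
              Q * (K * (Q * a * t) ^ n / fact n)) (at t within {0..x})"
        by (simp add: has_real_derivative_iff_has_vector_derivative)
    qed (use x in auto)
    have "norm (integral {0..x} (w (Suc n))) \<le>
        integral {0..x} (\<lambda>t. Q * (K * (Q * a * t) ^ n / fact n))"
    proof (rule integral_norm_bound_integral)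
      show "w (Suc n) integrable_on {0..x}"
        using x by (intro integrable_continuous_real continuous_on_subset[OF w_cont]) auto
      show "(\<lambda>t. Q * (K * (Q * a * t) ^ n / fact n)) integrable_on {0..x}"
        using int by (rule has_integral_integrable)
      show "norm (w (Suc n) t) \<le> Q * (K * (Q * a * t) ^ n / fact n)" if "t \<in> {0..x}" for t
      proof -
        have "norm (p t) * norm (u n t) \<le> Q * (K * (Q * a * t) ^ n / fact n)"
          using that x by (intro mult_mono Q IH Q0) auto
        then show ?thesis by (simp add: w_def norm_mult)
      qed
    qed
    then show ?thesis using integral_unique[OF int] by (simp add: vS)
  qed
  have u_bound: "norm (u n x) \<le> K * (Q * a * x) ^ n / fact n" if "x \<in> {0..a}" for n x
    using that
  proof (induction n arbitrary: x)
    case 0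
    have "norm (\<alpha> + \<beta> * of_real x) \<le> norm \<alpha> + norm \<beta> * \<bar>x\<bar>"
      by (metis norm_mult norm_of_real norm_triangle_ineq)
    also have "\<dots> \<le> K" unfolding K_def using 0 by (intro add_mono mult_left_mono) auto
    finally show ?case by (simp add: u0)
  next
    case (Suc n)
    have "norm (integral {0..x} (v (Suc n))) \<le>
        (Q * K * (Q * a) ^ n * x ^ Suc n / fact (Suc n)) * (x - 0)"
    proof (rule integral_bound)
      show "continuous_on {0..x} (v (Suc n))"
        using Suc.prems by (intro continuous_on_subset[OF v_cont[OF u_cont]]) auto
      fix t assume t: "t \<in> {0..x}"
      have "norm (v (Suc n) t) \<le> Q * K * (Q * a) ^ n * t ^ Suc n / fact (Suc n)"
        using t Suc.prems by (intro v_bound Suc.IH) auto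
      also have "\<dots> \<le> Q * K * (Q * a) ^ n * x ^ Suc n / fact (Suc n)"
        using t Suc.prems Q0 K0 \<open>0 \<le> a\<close>
        by (intro divide_right_mono mult_left_mono power_mono) auto
      finally show "norm (v (Suc n) t) \<le> Q * K * (Q * a) ^ n * x ^ Suc n / fact (Suc n)" .
    qed (use Suc.prems in auto)
    also have "\<dots> \<le> (Q * K * (Q * a) ^ n * x ^ Suc n / fact (Suc n)) * a"
      using Suc.prems Q0 K0 \<open>0 \<le> a\<close>
      by (intro mult_left_mono) (auto intro!: divide_nonneg_nonneg mult_nonneg_nonneg simp del: power_Suc fact_Suc)
    also have "\<dots> = K * (Q * a * x) ^ Suc n / fact (Suc n)"
      by (simp add: power_mult_distrib)
    finally show ?case by (simp only: uS)
  qed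
  define B where "B n = K * ((Q * a\<^sup>2) ^ n / fact n)" for n
  have B0: "0 \<le> B n" for n using K0 Q0 by (simp add: B_def)
  have uB: "norm (u n x) \<le> B n" if "x \<in> {0..a}" for n x
  proof -
    have "K * (Q * a * x) ^ n / fact n \<le> K * (Q * a * a) ^ n / fact n"
      using that Q0 K0 \<open>0 \<le> a\<close> by (intro divide_right_mono mult_left_mono power_mono) auto
    also have "\<dots> = B n" by (simp add: B_def power2_eq_square mult.assoc)
    finally show ?thesis using u_bound[OF that, of n] by linarith
  qed
  have wB: "norm (w n x) \<le> (case n of 0 \<Rightarrow> 0 | Suc m \<Rightarrow> Q * B m)" if "x \<in> {0..a}" for n x
    using that Q uB Q0 by (auto simp: w_def norm_mult intro!: mult_mono split: nat.split)
  have vB: "norm (v n x) \<le> (case n of 0 \<Rightarrow> norm \<beta> | Suc m \<Rightarrow> Q * B m * a)"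
    if "x \<in> {0..a}" for n x
  proof (cases n)
    case 0 then show ?thesis by (simp add: v_def)
  next
    case (Suc m)
    have "norm (integral {0..x} (w (Suc m))) \<le> Q * B m * (x - 0)"
    proof (rule integral_bound)
      show "continuous_on {0..x} (w (Suc m))"
        using that by (intro continuous_on_subset[OF w_cont]) auto
      show "norm (w (Suc m) t) \<le> Q * B m" if "t \<in> {0..x}" for t
        using wB[of t "Suc m"] that \<open>x \<in> {0..a}\<close> by auto
    qed (use that in auto)
    also have "\<dots> \<le> Q * B m * a"
      using that Q0 B0 by (intro mult_left_mono) auto
    finally show ?thesis by (simp add: Suc vS)
  qed
  have expB: "(\<lambda>n. B n) sums (K * exp (Q * a\<^sup>2))"
    unfolding B_def using exp_converges[of "Q * a\<^sup>2"]
    by (intro sums_mult) (simp add: field_simps)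
  then have sumB: "summable B" by (rule sums_summable)
  have sumw: "summable (\<lambda>n. case n of 0 \<Rightarrow> 0 | Suc m \<Rightarrow> Q * B m)"
    using sumB by (subst summable_Suc_iff [symmetric]) (simp add: summable_mult)
  have sumv: "summable (\<lambda>n. case n of 0 \<Rightarrow> norm \<beta> | Suc m \<Rightarrow> Q * B m * a)"
    using sumB by (subst summable_Suc_iff [symmetric]) (simp add: summable_mult summable_mult2)
  define y where "y x = (\<Sum>n. u n x)" for x
  define y' where "y' x = (\<Sum>n. v n x)" for x
  have u_sums: "(\<lambda>n. u n x) sums y x" if "x \<in> {0..a}" for x
    unfolding y_def by (rule summable_sums, rule summable_comparison_test[OF _ sumB]) (use uB that in auto)
  have v_sums: "(\<lambda>n. v n x) sums y' x" if "x \<in> {0..a}" for x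
    unfolding y'_def by (rule summable_sums, rule summable_comparison_test[OF _ sumv]) (use vB that in auto)
  have w_sums: "(\<lambda>n. w n x) sums (p x * y x)" if "x \<in> {0..a}" for x
    using sums_mult[OF u_sums[OF that], of "p x"] sums_Suc[of "\<lambda>n. w n x" "p x * y x"]
    by (simp add: w_def)
  have v_lim: "uniform_limit {0..a} (\<lambda>n x. \<Sum>i<n. v i x) y' sequentially"
    unfolding y'_def by (rule Weierstrass_m_test[OF _ sumv]) (use vB in auto)
  have "uniform_limit {0..a} (\<lambda>n x. \<Sum>i<n. w i x) (\<lambda>x. \<Sum>i. w i x) sequentially"
    by (rule Weierstrass_m_test[OF _ sumw]) (use wB in auto)
  then have w_lim: "uniform_limit {0..a} (\<lambda>n x. \<Sum>i<n. w i x) (\<lambda>x. p x * y x) sequentially"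
    by (rule uniform_limit_cong'[THEN iffD1, rotated -1]) (use w_sums in \<open>auto simp: sums_iff\<close>)
  have "ode_sol a p y y'"
    unfolding ode_sol_def
  proof (intro ballI conjI)
    fix x assume x: "x \<in> {0..a}"
    show "(y has_vector_derivative y' x) (at x within {0..a})"
      by (rule has_vector_derivative_series[OF _ u_deriv v_lim u_sums x]) auto
    show "(y' has_vector_derivative p x * y x) (at x within {0..a})"
      by (rule has_vector_derivative_series[OF _ v_deriv w_lim v_sums x]) auto
  qed
  moreover have "y 0 = \<alpha>"
  proof -
    have "u n 0 = (if n = 0 then \<alpha> else 0)" for n by (cases n) (auto simp: u0 uS)
    then show ?thesis unfolding y_def using sums_single[of 0 "\<lambda>_. \<alpha>"] by (simp add: sums_iff)
  qed
  moreover have "y' 0 = \<beta>"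
  proof -
    have "v n 0 = (if n = 0 then \<beta> else 0)" for n by (cases n) (auto simp: v_def)
    then show ?thesis unfolding y'_def using sums_single[of 0 "\<lambda>_. \<beta>"] by (simp add: sums_iff)
  qed
  moreover have "norm (y x) \<le> K * exp (Q * a\<^sup>2)" if "x \<in> {0..a}" for x
    unfolding sums_unique[OF expB] y_def
    using uB that by (intro norm_suminf_le sumB) auto
  ultimately show ?thesis using that unfolding K_def by blast
qed

text \<open>Variation of constants: the Wronskians of \<^term>\<open>y\<close> with the two solutions of a fundamental
  system are its initial data, and Cramer's rule recovers \<^term>\<open>y\<close>.\<close>

lemma ode_sol_decompose:
  assumes y: "ode_sol a p y y'" and c: "ode_sol a p c c'" and s: "ode_sol a p s s'"
    and ini: "c 0 = 1" "c' 0 = 0" "s 0 = 0" "s' 0 = 1" and x: "x \<in> {0..a}"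
  shows "y x = y 0 * c x + y' 0 * s x" "y' x = y 0 * c' x + y' 0 * s' x"
proof -
  have W: "y' 0 = y' x * c x - y x * c' x" "y 0 = y x * s' x - y' x * s x"
    and cs: "c x * s' x - c' x * s x = 1"
    using ode_sol_wronskian[OF y c x] ode_sol_wronskian[OF y s x] ode_sol_wronskian[OF c s x] ini
    by (auto simp: algebra_simps)
  have "y x = y x * (c x * s' x - c' x * s x)" by (simp add: cs)
  also have "\<dots> = y 0 * c x + y' 0 * s x" unfolding W by (simp add: algebra_simps)
  finally show "y x = y 0 * c x + y' 0 * s x" .
  have "y' x = y' x * (c x * s' x - c' x * s x)" by (simp add: cs)
  also have "\<dots> = y 0 * c' x + y' 0 * s' x" unfolding W by (simp add: algebra_simps)
  finally show "y' x = y 0 * c' x + y' 0 * s' x" .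
qed

text \<open>Both solutions have the same coordinates in one fundamental system, so uniqueness comes
  down to constant Wronskians.\<close>

lemma ode_sol_unique:
  assumes "continuous_on {0..a} p" "ode_sol a p y y'" "ode_sol a p z z'"
    and "y 0 = z 0" "y' 0 = z' 0" "x \<in> {0..a}"
  shows "y x = z x" "y' x = z' x"
proof -
  have "0 \<le> a" using assms by auto
  have "bounded (p ` {0..a})"
    using assms(1) by (intro compact_imp_bounded compact_continuous_image) auto
  then obtain Q where Q: "\<And>x. x \<in> {0..a} \<Longrightarrow> norm (p x) \<le> Q"
    unfolding bounded_iff by blast
  obtain c c' where c: "ode_sol a p c c'" "c 0 = 1" "c' 0 = 0"
    using ode_sol_exists[OF \<open>0 \<le> a\<close> assms(1) Q] by metis
  obtain s s' where s: "ode_sol a p s s'" "s 0 = 0" "s' 0 = 1"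
    using ode_sol_exists[OF \<open>0 \<le> a\<close> assms(1) Q] by metis
  show "y x = z x" "y' x = z' x"
    using ode_sol_decompose[OF assms(2) c(1) s(1) c(2,3) s(2,3) assms(6)]
      ode_sol_decompose[OF assms(3) c(1) s(1) c(2,3) s(2,3) assms(6)] assms by auto
qed

section \<open>Solutions as functions of the spectral parameter\<close>

text \<open>With \<open>p = q - \<mu>\<close> the equation reads
  \<open>- y'' + q * y = \<mu> * y\<close>. The potential is real, but the parameter runs through
  the whole complex plane, where the arguments on zeros and growth take place.\<close>

definition sl_family ::
  "real \<Rightarrow> (real \<Rightarrow> real) \<Rightarrow> complex \<Rightarrow> complex \<Rightarrow>
   (complex \<Rightarrow> real \<Rightarrow> complex) \<Rightarrow> (complex \<Rightarrow> real \<Rightarrow> complex) \<Rightarrow> bool" where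
  "sl_family a q \<alpha> \<beta> Y Y' \<longleftrightarrow> (\<forall>\<mu>.
     ode_sol a (\<lambda>x. of_real (q x) - \<mu>) (Y \<mu>) (Y' \<mu>) \<and> Y \<mu> 0 = \<alpha> \<and> Y' \<mu> 0 = \<beta>)"

lemma sl_familyD:
  assumes "sl_family a q \<alpha> \<beta> Y Y'"
  shows "ode_sol a (\<lambda>x. of_real (q x) - \<mu>) (Y \<mu>) (Y' \<mu>)" "Y \<mu> 0 = \<alpha>" "Y' \<mu> 0 = \<beta>"
  using assms unfolding sl_family_def by auto

lemma continuous_bounded_interval:
  fixes q :: "real \<Rightarrow> real"
  assumes "0 \<le> a" "continuous_on {0..a} q"
  obtains Q where "0 \<le> Q" "\<And>x. x \<in> {0..a} \<Longrightarrow> \<bar>q x\<bar> \<le> Q"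
proof -
  have "bounded (q ` {0..a})"
    using assms by (intro compact_imp_bounded compact_continuous_image) auto
  then obtain Q where "Q > 0" "\<And>x. x \<in> {0..a} \<Longrightarrow> \<bar>q x\<bar> \<le> Q"
    unfolding bounded_pos by auto
  then show ?thesis using that[of Q] by auto
qed

lemma sl_sol_exists:
  fixes q :: "real \<Rightarrow> real"
  assumes "0 \<le> a" and q: "continuous_on {0..a} q" and Q: "\<And>x. x \<in> {0..a} \<Longrightarrow> \<bar>q x\<bar> \<le> Q"
  obtains y y' where "ode_sol a (\<lambda>x. of_real (q x) - \<mu>) y y'" "y 0 = \<alpha>" "y' 0 = \<beta>"
    "\<And>x. x \<in> {0..a} \<Longrightarrow> norm (y x) \<le> (norm \<alpha> + norm \<beta> * a) * exp ((Q + norm \<mu>) * a\<^sup>2)"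
proof (rule ode_sol_exists[OF \<open>0 \<le> a\<close>, of "\<lambda>x. of_real (q x) - \<mu>" "Q + norm \<mu>" \<alpha> \<beta>])
  show "continuous_on {0..a} (\<lambda>x. complex_of_real (q x) - \<mu>)"
    by (intro continuous_intros q)
  show "norm (complex_of_real (q x) - \<mu>) \<le> Q + norm \<mu>" if "x \<in> {0..a}" for x
    using Q[OF that] norm_triangle_ineq4[of "complex_of_real (q x)" \<mu>] by simp
qed (use that in blast)

lemma sl_family_exists:
  assumes "0 \<le> a" "continuous_on {0..a} q"
  obtains Y Y' where "sl_family a q \<alpha> \<beta> Y Y'"
proof -
  obtain Q where Q: "\<And>x. x \<in> {0..a} \<Longrightarrow> \<bar>q x\<bar> \<le> Q"
    using continuous_bounded_interval[OF assms] by blast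
  have "\<exists>y y'. ode_sol a (\<lambda>x. of_real (q x) - \<mu>) y y' \<and> y 0 = \<alpha> \<and> y' 0 = \<beta>" for \<mu>
    by (rule sl_sol_exists[OF assms Q, of \<mu> \<alpha> \<beta>]) blast+
  then obtain Y Y' where
    "\<forall>\<mu>. ode_sol a (\<lambda>x. of_real (q x) - \<mu>) (Y \<mu>) (Y' \<mu>) \<and> Y \<mu> 0 = \<alpha> \<and> Y' \<mu> 0 = \<beta>"
    by metis
  then show ?thesis using that unfolding sl_family_def by blast
qed

lemma sl_sol_unique:
  fixes q :: "real \<Rightarrow> real"
  assumes "continuous_on {0..a} q"
    and "ode_sol a (\<lambda>x. of_real (q x) - \<mu>) y y'" "ode_sol a (\<lambda>x. of_real (q x) - \<mu>) z z'"
    and "y 0 = z 0" "y' 0 = z' 0" "x \<in> {0..a}"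
  shows "y x = z x" "y' x = z' x"
proof -
  have "continuous_on {0..a} (\<lambda>x. complex_of_real (q x) - \<mu>)"
    by (intro continuous_intros assms)
  from ode_sol_unique[OF this assms(2-6)] show "y x = z x" "y' x = z' x" .
qed

lemma sl_sol_multiple:
  fixes q :: "real \<Rightarrow> real"
  assumes "continuous_on {0..a} q" "sl_family a q 1 \<beta> Y Y'"
    and y: "ode_sol a (\<lambda>x. of_real (q x) - \<mu>) y y'" "y' 0 = y 0 * \<beta>" and x: "x \<in> {0..a}"
  shows "y x = y 0 * Y \<mu> x" "y' x = y 0 * Y' \<mu> x"
  using sl_sol_unique[OF assms(1) y(1) ode_sol_combine[OF sl_familyD(1) sl_familyD(1), OF assms(2,2), of _ "y 0" 0] _ _ x]
    sl_familyD(2,3)[OF assms(2)] y(2) by auto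

text \<open>By uniqueness each member of the family is the Picard solution, whose bound depends on
  the parameter only through its modulus.\<close>

lemma sl_family_bounded:
  assumes "0 \<le> a" "continuous_on {0..a} q" "sl_family a q \<alpha> \<beta> Y Y'"
  obtains B where "0 \<le> B" "\<And>\<mu> x. norm \<mu> \<le> M \<Longrightarrow> x \<in> {0..a} \<Longrightarrow> norm (Y \<mu> x) \<le> B"
proof -
  obtain Q where Q: "0 \<le> Q" "\<And>x. x \<in> {0..a} \<Longrightarrow> \<bar>q x\<bar> \<le> Q"
    using continuous_bounded_interval[OF assms(1,2)] by blast
  define B where "B = (norm \<alpha> + norm \<beta> * a) * exp ((Q + M) * a\<^sup>2)"
  have "norm (Y \<mu> x) \<le> B" if "norm \<mu> \<le> M" "x \<in> {0..a}" for \<mu> x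
  proof -
    obtain y y' where y: "ode_sol a (\<lambda>x. of_real (q x) - \<mu>) y y'" "y 0 = \<alpha>" "y' 0 = \<beta>"
      "\<And>x. x \<in> {0..a} \<Longrightarrow> norm (y x) \<le> (norm \<alpha> + norm \<beta> * a) * exp ((Q + norm \<mu>) * a\<^sup>2)"
      using sl_sol_exists[OF assms(1,2) Q(2), of \<mu> \<alpha> \<beta>] by blast
    have "norm (Y \<mu> x) = norm (y x)"
      using sl_sol_unique(1)[OF assms(2) sl_familyD(1)[OF assms(3)] y(1) _ _ that(2)]
        sl_familyD(2,3)[OF assms(3)] y(2,3) by simp
    also have "\<dots> \<le> (norm \<alpha> + norm \<beta> * a) * exp ((Q + norm \<mu>) * a\<^sup>2)" by (rule y(4)[OF that(2)])
    also have "\<dots> \<le> B"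
      unfolding B_def using that(1) \<open>0 \<le> a\<close> by (intro mult_left_mono) (auto intro!: mult_right_mono)
    finally show ?thesis .
  qed
  moreover have "0 \<le> B" using \<open>0 \<le> a\<close> by (simp add: B_def)
  ultimately show ?thesis using that by blast
qed

text \<open>Lagrange's identity turns the difference quotient in the spectral parameter of a solution's
  Wronskian with a solution for the fixed parameter \<open>\<mu>\<close> into an integral, so that
  holomorphy only needs local boundedness.\<close>

lemma sl_family_holomorphic:
  assumes "0 \<le> a" "continuous_on {0..a} q" and fam: "sl_family a q \<alpha> \<beta> Y Y'" and x: "x \<in> {0..a}"
  shows "(\<lambda>\<mu>. Y \<mu> x) holomorphic_on UNIV" "(\<lambda>\<mu>. Y' \<mu> x) holomorphic_on UNIV"
proof -
  have "(\<lambda>\<mu>. Y \<mu> x) field_differentiable at \<mu> \<and> (\<lambda>\<mu>. Y' \<mu> x) field_differentiable at \<mu>" for \<mu>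
  proof -
    let ?p = "\<lambda>\<mu> x. complex_of_real (q x) - \<mu>"
    obtain B where B: "0 \<le> B" "\<And>\<nu> x. norm \<nu> \<le> norm \<mu> + 1 \<Longrightarrow> x \<in> {0..a} \<Longrightarrow> norm (Y \<nu> x) \<le> B"
      using sl_family_bounded[OF assms(1-3)] by metis
    obtain C C' where C: "sl_family a q 1 0 C C'" using sl_family_exists[OF assms(1,2)] .
    obtain S S' where S: "sl_family a q 0 1 S S'" using sl_family_exists[OF assms(1,2)] .
    obtain M1 where M1: "0 \<le> M1" "\<And>x. x \<in> {0..a} \<Longrightarrow> norm (C \<mu> x) \<le> M1"
      using sl_family_bounded[OF assms(1,2) C] by (metis order_refl)
    obtain M2 where M2: "0 \<le> M2" "\<And>x. x \<in> {0..a} \<Longrightarrow> norm (S \<mu> x) \<le> M2"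
      using sl_family_bounded[OF assms(1,2) S] by (metis order_refl)
    have CS: "C' \<mu> t * S \<mu> t - C \<mu> t * S' \<mu> t = -1" if "t \<in> {0..a}" for t
      using ode_sol_wronskian[OF sl_familyD(1)[OF C] sl_familyD(1)[OF S] that]
        sl_familyD(2,3)[OF C] sl_familyD(2,3)[OF S] by auto
    \<comment> \<open>As \<open>C\<close> and \<open>S\<close> form a fundamental system, the
      coefficients can give \<open>z\<close> the data \<open>(0, 1)\<close> or \<open>(1, 0)\<close>
      at any chosen point; the Wronskian \<open>D\<close> is then \<open>- Y \<nu>\<close> or
      \<open>Y' \<nu>\<close> at that point.\<close>
    define z where "z b c t = b * C \<mu> t + c * S \<mu> t" for b c t
    define z' where "z' b c t = b * C' \<mu> t + c * S' \<mu> t" for b c t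
    have z: "ode_sol a (?p \<mu>) (z b c) (z' b c)" for b c
      unfolding z_def z'_def by (intro ode_sol_combine sl_familyD(1)[OF C] sl_familyD(1)[OF S])
    have zb: "norm (z b c t) \<le> norm b * M1 + norm c * M2" if "t \<in> {0..a}" for b c t
      unfolding z_def using M1(2)[OF that] M2(2)[OF that]
      by (intro order_trans[OF norm_triangle_ineq] add_mono) (auto simp: norm_mult intro!: mult_left_mono)
    have zc: "continuous_on {0..a} (z b c)" for b c using ode_sol_continuous(1)[OF z] .
    have Yc: "continuous_on {0..a} (Y \<nu>)" for \<nu> using ode_sol_continuous(1)[OF sl_familyD(1)[OF fam]] .
    define D where "D b c t \<nu> = Y' \<nu> t * z b c t - Y \<nu> t * z' b c t" for b c t \<nu>
    define J where "J b c t \<nu> = integral {0..t} (\<lambda>s. Y \<nu> s * z b c s)" for b c t \<nu>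
    have D_diff: "D b c t \<nu> - D b c t \<mu> = (\<mu> - \<nu>) * J b c t \<nu>" if t: "t \<in> {0..a}" for b c t \<nu>
    proof -
      let ?k = "\<beta> * z b c 0 - \<alpha> * z' b c 0"
      have "((\<lambda>s. (\<mu> - \<nu>) * (Y \<nu> s * z b c s)) has_integral D b c t \<nu> - ?k) {0..t}" for \<nu>
        using ode_sol_lagrange[OF sl_familyD(1)[OF fam, of \<nu>] z t] sl_familyD(2,3)[OF fam]
        unfolding D_def by simp
      from integral_unique[OF this[of \<nu>]] integral_unique[OF this[of \<mu>]]
      have "(\<mu> - \<nu>) * J b c t \<nu> = D b c t \<nu> - ?k" "0 = D b c t \<mu> - ?k"
        unfolding J_def by (simp_all only: integral_mult_right diff_self mult_zero_left integral_0)
      then show ?thesis by simp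
    qed
    have int_bound: "norm (integral {0..t} (\<lambda>s. f s * z b c s)) \<le> F * (norm b * M1 + norm c * M2) * a"
      if t: "t \<in> {0..a}" and f: "continuous_on {0..a} f" "\<And>s. s \<in> {0..a} \<Longrightarrow> norm (f s) \<le> F"
      for f b c t F
    proof -
      have F0: "0 \<le> F" using f(2)[of t] t norm_ge_zero order_trans by blast
      have "norm (integral {0..t} (\<lambda>s. f s * z b c s)) \<le> F * (norm b * M1 + norm c * M2) * (t - 0)"
      proof (rule integral_bound)
        show "continuous_on {0..t} (\<lambda>s. f s * z b c s)"
          by (rule continuous_on_subset[of "{0..a}"]) (use t in \<open>auto intro!: continuous_intros f zc\<close>)
        show "norm (f s * z b c s) \<le> F * (norm b * M1 + norm c * M2)" if "s \<in> {0..t}" for s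
          using that t f zb F0 by (auto simp: norm_mult intro!: mult_mono)
      qed (use t in auto)
      also have "\<dots> \<le> F * (norm b * M1 + norm c * M2) * a"
        using t F0 M1(1) M2(1) by (intro mult_left_mono) auto
      finally show ?thesis .
    qed
    define L where "L = B * (M2 * M1 + M1 * M2) * a"
    have L0: "0 \<le> L" using B(1) M1(1) M2(1) \<open>0 \<le> a\<close> by (simp add: L_def)
    \<comment> \<open>For data \<open>(0, 1)\<close> at \<open>t\<close>, \<open>D_diff\<close> and
      local boundedness give a Lipschitz estimate in the parameter that is uniform in
      \<open>t\<close>.\<close>
    have lip: "norm (Y \<nu> t - Y \<mu> t) \<le> norm (\<nu> - \<mu>) * L"
      if nu: "norm (\<nu> - \<mu>) < 1" and t: "t \<in> {0..a}" for \<nu> t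
    proof -
      have nu': "norm \<nu> \<le> norm \<mu> + 1" using nu norm_triangle_sub[of \<nu> \<mu>] by simp
      let ?b = "- S \<mu> t" and ?c = "C \<mu> t"
      have "z ?b ?c t = 0" by (simp add: z_def)
      moreover have "z' ?b ?c t = 1" using CS[OF t] by (simp add: z'_def algebra_simps)
      ultimately have "Y \<nu> t - Y \<mu> t = - (D ?b ?c t \<nu> - D ?b ?c t \<mu>)" by (simp add: D_def)
      then have "norm (Y \<nu> t - Y \<mu> t) = norm (\<nu> - \<mu>) * norm (J ?b ?c t \<nu>)"
        using D_diff[OF t, of ?b ?c \<nu>] by (simp add: norm_mult norm_minus_commute)
      also have "norm (J ?b ?c t \<nu>) \<le> B * (norm ?b * M1 + norm ?c * M2) * a"
        unfolding J_def using B(2)[OF nu'] by (intro int_bound t Yc)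
      also have "\<dots> \<le> L"
        unfolding L_def using t M1 M2 B(1) \<open>0 \<le> a\<close>
        by (intro mult_right_mono mult_left_mono add_mono) auto
      finally show ?thesis by (simp add: mult_left_mono)
    qed
    \<comment> \<open>By \<open>D_diff\<close> the difference quotient is exactly
      \<open>- J b c x \<nu>\<close>, and \<open>lip\<close> allows the limit to pass under the
      integral.\<close>
    have D_deriv: "(D b c x has_field_derivative - J b c x \<mu>) (at \<mu>)" for b c
      unfolding has_field_derivative_iff
    proof (rule LIM_zero_cancel, rule Lim_null_comparison)
      let ?K = "L * (norm b * M1 + norm c * M2) * a"
      show "\<forall>\<^sub>F \<nu> in at \<mu>. norm ((D b c x \<nu> - D b c x \<mu>) / (\<nu> - \<mu>) - - J b c x \<mu>)
               \<le> norm (\<nu> - \<mu>) * ?K"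
        unfolding eventually_at
      proof (intro exI[of _ 1] conjI ballI impI)
        fix \<nu> assume "\<nu> \<noteq> \<mu> \<and> dist \<nu> \<mu> < 1"
        then have nu: "\<nu> \<noteq> \<mu>" "norm (\<nu> - \<mu>) < 1" by (auto simp: dist_norm)
        have "(D b c x \<nu> - D b c x \<mu>) / (\<nu> - \<mu>) - - J b c x \<mu> = - (J b c x \<nu> - J b c x \<mu>)"
          using nu(1) D_diff[OF x, of b c \<nu>] by (simp add: field_simps)
        also have "J b c x \<nu> - J b c x \<mu> = integral {0..x} (\<lambda>s. (Y \<nu> s - Y \<mu> s) * z b c s)"
        proof -
          have "continuous_on {0..x} (\<lambda>s. Y \<nu> s * z b c s)" for \<nu>
            by (rule continuous_on_subset[of "{0..a}"]) (use x in \<open>auto intro!: continuous_intros Yc zc\<close>)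
          then show ?thesis unfolding J_def
            by (simp add: left_diff_distrib Henstock_Kurzweil_Integration.integral_diff integrable_continuous_real)
        qed
        also have "norm (- \<dots>) \<le> norm (\<nu> - \<mu>) * L * (norm b * M1 + norm c * M2) * a"
          unfolding norm_minus_cancel using lip[OF nu(2)] by (intro int_bound x continuous_intros Yc)
        finally show "norm ((D b c x \<nu> - D b c x \<mu>) / (\<nu> - \<mu>) - - J b c x \<mu>) \<le> norm (\<nu> - \<mu>) * ?K"
          by (simp add: mult.assoc)
      qed auto
      show "((\<lambda>\<nu>. norm (\<nu> - \<mu>) * ?K) \<longlongrightarrow> 0) (at \<mu>)"
        by (auto intro!: tendsto_eq_intros)
    qed
    have "Y \<nu> x = - D (- S \<mu> x) (C \<mu> x) x \<nu>" "Y' \<nu> x = D (S' \<mu> x) (- C' \<mu> x) x \<nu>" for \<nu>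
    proof -
      have 1: "C \<mu> x * S' \<mu> x = 1 + C' \<mu> x * S \<mu> x" using CS[OF x] by (simp add: algebra_simps)
      show "Y \<nu> x = - D (- S \<mu> x) (C \<mu> x) x \<nu>"
        unfolding D_def z_def z'_def using 1 by (simp add: algebra_simps)
      have "z (S' \<mu> x) (- C' \<mu> x) x = 1" "z' (S' \<mu> x) (- C' \<mu> x) x = 0"
        unfolding z_def z'_def using 1 by (simp_all add: algebra_simps)
      then show "Y' \<nu> x = D (S' \<mu> x) (- C' \<mu> x) x \<nu>" by (simp add: D_def)
    qed
    then show ?thesis
      using D_deriv unfolding field_differentiable_def by (auto intro!: derivative_eq_intros exI)
  qed
  then show "(\<lambda>\<mu>. Y \<mu> x) holomorphic_on UNIV" "(\<lambda>\<mu>. Y' \<mu> x) holomorphic_on UNIV"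
    unfolding holomorphic_on_def by auto
qed

section \<open>Asymptotics and large squares\<close>

lemma norm_sin_le_exp: "norm (sin (w::complex)) \<le> exp \<bar>Im w\<bar>"
  using cmod_sin_le_exp[of 1 w] by simp

lemma norm_cos_le_exp: "norm (cos (w::complex)) \<le> exp \<bar>Im w\<bar>"
  using cmod_cos_le_exp[of 1 w] by simp

lemma has_vector_derivative_of_real_chain:
  fixes F :: "complex \<Rightarrow> complex"
  assumes "(F has_field_derivative F') (at (\<rho> * of_real (x - t)))"
  shows "((\<lambda>t. F (\<rho> * of_real (x - t))) has_vector_derivative - \<rho> * F') (at t within A)"
proof -
  have "((\<lambda>t. \<rho> * complex_of_real (x - t)) has_vector_derivative - \<rho>) (at t within A)"
    by (auto intro!: derivative_eq_intros simp: algebra_simps)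
  from field_vector_diff_chain_within[OF this has_field_derivative_at_within[OF assms]]
  show ?thesis by (simp add: o_def)
qed

text \<open>Free solutions with data prescribed at \<open>x\<close> instead of \<open>0\<close>, so
  that the boundary term of Lagrange's identity at \<open>x\<close> is just \<open>y' x\<close> or
  \<open>y x\<close>.\<close>

lemma ode_sol_trig:
  "ode_sol a (\<lambda>_. - \<rho>\<^sup>2) (\<lambda>t. cos (\<rho> * of_real (x - t))) (\<lambda>t. \<rho> * sin (\<rho> * of_real (x - t)))"
  "\<rho> \<noteq> 0 \<Longrightarrow> ode_sol a (\<lambda>_. - \<rho>\<^sup>2) (\<lambda>t. sin (\<rho> * of_real (x - t)) / \<rho>) (\<lambda>t. - cos (\<rho> * of_real (x - t)))"
proof -
  have c: "((\<lambda>t. cos (\<rho> * of_real (x - t))) has_vector_derivative - \<rho> * - sin (\<rho> * of_real (x - t)))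
      (at t within A)" for t A
    by (rule has_vector_derivative_of_real_chain) (auto intro!: derivative_eq_intros)
  have s: "((\<lambda>t. sin (\<rho> * of_real (x - t))) has_vector_derivative - \<rho> * cos (\<rho> * of_real (x - t)))
      (at t within A)" for t A
    by (rule has_vector_derivative_of_real_chain) (auto intro!: derivative_eq_intros)
  show "ode_sol a (\<lambda>_. - \<rho>\<^sup>2) (\<lambda>t. cos (\<rho> * of_real (x - t))) (\<lambda>t. \<rho> * sin (\<rho> * of_real (x - t)))"
    using c has_vector_derivative_mult_right[OF s, of \<rho>]
    unfolding ode_sol_def by (simp add: power2_eq_square mult.assoc)
  show "ode_sol a (\<lambda>_. - \<rho>\<^sup>2) (\<lambda>t. sin (\<rho> * of_real (x - t)) / \<rho>) (\<lambda>t. - cos (\<rho> * of_real (x - t)))"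
    if "\<rho> \<noteq> 0"
    using has_vector_derivative_mult_right[OF s, of "inverse \<rho>"] has_vector_derivative_minus[OF c] that
    unfolding ode_sol_def by (simp add: power2_eq_square field_simps)
qed

text \<open>Duhamel's formula is Lagrange's identity against the free solutions; the sup norm weighted
  with \<open>exp (- \<bar>Im \<rho>\<bar> x)\<close> closes the estimate once \<open>\<rho>\<close> is large.\<close>

lemma sl_asymptotics:
  fixes q :: "real \<Rightarrow> real"
  assumes sol: "ode_sol a (\<lambda>x. of_real (q x) - \<rho>\<^sup>2) y y'" and "0 \<le> a"
    and qc: "continuous_on {0..a} q" and Q: "\<And>x. x \<in> {0..a} \<Longrightarrow> \<bar>q x\<bar> \<le> Q"
    and \<rho>: "\<rho> \<noteq> 0" "2 * Q * a \<le> norm \<rho>" and x: "x \<in> {0..a}"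
  defines "m \<equiv> 2 * (norm (y 0) + norm (y' 0) / norm \<rho>)"
  shows "norm (y x) \<le> m * exp (\<bar>Im \<rho>\<bar> * x)"
    and "norm (y x - y 0 * cos (\<rho> * x)) \<le> (norm (y' 0) + Q * a * m) * exp (\<bar>Im \<rho>\<bar> * x) / norm \<rho>"
    and "norm (y' x + y 0 * \<rho> * sin (\<rho> * x)) \<le> (norm (y' 0) + Q * a * m) * exp (\<bar>Im \<rho>\<bar> * x)"
proof -
  let ?\<tau> = "\<bar>Im \<rho>\<bar>"
  have Q0: "0 \<le> Q" using Q[of 0] \<open>0 \<le> a\<close> by auto
  have yc: "continuous_on {0..a} y" using ode_sol_continuous(1)[OF sol] .
  have im: "\<bar>Im (\<rho> * of_real (r - t))\<bar> = ?\<tau> * (r - t)" if "t \<le> r" for r t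
    using that by (simp add: abs_mult)
  have dS: "integral {0..r} (\<lambda>t. of_real (q t) * (y t * (sin (\<rho> * of_real (r - t)) / \<rho>)))
      = y r - (y 0 * cos (\<rho> * r) + y' 0 * sin (\<rho> * r) / \<rho>)" if "r \<in> {0..a}" for r
    using ode_sol_lagrange[OF sol ode_sol_trig(2)[OF \<rho>(1)] that, of r]
    by (intro integral_unique) (simp add: algebra_simps)
  have dC: "integral {0..x} (\<lambda>t. of_real (q t) * (y t * cos (\<rho> * of_real (x - t))))
      = y' x - (y' 0 * cos (\<rho> * x) - y 0 * \<rho> * sin (\<rho> * x))"
    using ode_sol_lagrange[OF sol ode_sol_trig(1)[of a \<rho> x] x]
    by (intro integral_unique) (simp add: algebra_simps)
  \<comment> \<open>One estimate for both Duhamel integrals: the weights at \<open>t\<close> and at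
    \<open>r - t\<close> multiply to the weight at \<open>r\<close>, whatever \<open>t\<close>
    is.\<close>
  have bnd: "norm (integral {0..r} (\<lambda>t. of_real (q t) * (y t * G (r - t)))) \<le> Q * \<mu> * k * exp (?\<tau> * r) * a"
    if r: "r \<in> {0..a}" and \<mu>: "\<And>t. t \<in> {0..a} \<Longrightarrow> norm (y t) \<le> \<mu> * exp (?\<tau> * t)"
      and G: "continuous_on UNIV G" "\<And>u. 0 \<le> u \<Longrightarrow> norm (G u) \<le> k * exp (?\<tau> * u)"
    for r \<mu> k and G :: "real \<Rightarrow> complex"
  proof -
    have "0 \<le> \<mu> * exp (?\<tau> * 0)" using \<mu>[of 0] \<open>0 \<le> a\<close> by (intro order_trans[OF norm_ge_zero]) auto
    then have \<mu>0: "0 \<le> \<mu>" by simp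
    have "0 \<le> k * exp (?\<tau> * 0)" using G(2)[of 0] order_trans[OF norm_ge_zero] by blast
    then have k0: "0 \<le> k" by simp
    have "norm (integral {0..r} (\<lambda>t. of_real (q t) * (y t * G (r - t)))) \<le> (Q * \<mu> * k * exp (?\<tau> * r)) * (r - 0)"
    proof (rule integral_bound)
      have "continuous_on {0..a} (\<lambda>t. of_real (q t) * (y t * G (r - t)))"
        by (intro continuous_intros qc yc continuous_on_compose2[OF G(1)]) auto
      then show "continuous_on {0..r} (\<lambda>t. of_real (q t) * (y t * G (r - t)))"
        by (rule continuous_on_subset) (use r in auto)
      fix t assume t: "t \<in> {0..r}"
      have "norm (of_real (q t) * (y t * G (r - t))) = \<bar>q t\<bar> * (norm (y t) * norm (G (r - t)))"
        by (simp add: norm_mult)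
      also have "\<dots> \<le> Q * ((\<mu> * exp (?\<tau> * t)) * (k * exp (?\<tau> * (r - t))))"
        using t r Q0 \<mu>0 k0 by (intro mult_mono Q \<mu> G) auto
      also have "\<dots> = Q * \<mu> * k * exp (?\<tau> * r)"
        by (simp add: exp_add [symmetric] algebra_simps)
      finally show "norm (of_real (q t) * (y t * G (r - t))) \<le> Q * \<mu> * k * exp (?\<tau> * r)" .
    qed (use r in auto)
    also have "\<dots> \<le> (Q * \<mu> * k * exp (?\<tau> * r)) * a"
      using r Q0 \<mu>0 k0 by (intro mult_left_mono) auto
    finally show ?thesis .
  qed
  have cosb: "norm (cos (\<rho> * of_real u)) \<le> exp (?\<tau> * u)"
    and sinb: "norm (sin (\<rho> * of_real u)) \<le> exp (?\<tau> * u)" if "0 \<le> u" for u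
    using norm_cos_le_exp[of "\<rho> * of_real u"] norm_sin_le_exp[of "\<rho> * of_real u"] im[of 0 u] that by auto
  have bS: "norm (y r - (y 0 * cos (\<rho> * r) + y' 0 * sin (\<rho> * r) / \<rho>)) \<le> Q * \<mu> * exp (?\<tau> * r) * a / norm \<rho>"
    if "r \<in> {0..a}" "\<And>t. t \<in> {0..a} \<Longrightarrow> norm (y t) \<le> \<mu> * exp (?\<tau> * t)" for r \<mu>
  proof -
    have "norm (integral {0..r} (\<lambda>t. of_real (q t) * (y t * (sin (\<rho> * of_real (r - t)) / \<rho>))))
        \<le> Q * \<mu> * (1 / norm \<rho>) * exp (?\<tau> * r) * a"
      using sinb by (intro bnd that) (auto intro!: continuous_intros divide_right_mono simp: norm_divide \<rho>)
    then show ?thesis unfolding dS[OF that(1)] by simp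
  qed
  define w where "w t = norm (y t) * exp (- ?\<tau> * t)" for t
  have "\<exists>r\<in>{0..a}. \<forall>t\<in>{0..a}. w t \<le> w r"
    unfolding w_def using \<open>0 \<le> a\<close>
    by (intro continuous_attains_sup continuous_intros yc) auto
  then obtain r where r: "r \<in> {0..a}" "\<And>t. t \<in> {0..a} \<Longrightarrow> w t \<le> w r" by blast
  have wy: "norm (y t) = w t * exp (?\<tau> * t)" for t
    by (simp add: w_def mult.assoc exp_add [symmetric])
  have yw: "norm (y t) \<le> w r * exp (?\<tau> * t)" if "t \<in> {0..a}" for t
    unfolding wy by (intro mult_right_mono r that) auto
  have w0: "0 \<le> w r" by (simp add: w_def)
  have "w r * exp (?\<tau> * r) = norm (y r)" by (simp add: wy)
  also have "\<dots> \<le> norm (y r - (y 0 * cos (\<rho> * r) + y' 0 * sin (\<rho> * r) / \<rho>))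
      + (norm (y 0 * cos (\<rho> * r)) + norm (y' 0 * sin (\<rho> * r) / \<rho>))"
    by norm
  also have "\<dots> \<le> Q * w r * exp (?\<tau> * r) * a / norm \<rho> + (norm (y 0) * exp (?\<tau> * r)
      + norm (y' 0) * exp (?\<tau> * r) / norm \<rho>)"
    using r(1) cosb[of r] sinb[of r] unfolding norm_mult norm_divide
    by (intro add_mono bS yw divide_right_mono mult_left_mono) auto
  also have "\<dots> = (w r * (Q * a / norm \<rho>) + m / 2) * exp (?\<tau> * r)"
    unfolding m_def using \<rho> by (simp add: field_simps)
  \<comment> \<open>Largeness of \<open>\<rho>\<close> enters here: half of the maximum is absorbed
    on the left, which explains the factor 2 in \<open>m\<close>.\<close>
  also have "\<dots> \<le> (w r * (1 / 2) + m / 2) * exp (?\<tau> * r)"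
    using \<rho> w0 by (intro mult_right_mono add_right_mono mult_left_mono) (auto simp: field_simps)
  finally have "w r \<le> w r * (1 / 2) + m / 2" by simp
  then have "w r \<le> m" by simp
  then have ym: "norm (y t) \<le> m * exp (?\<tau> * t)" if "t \<in> {0..a}" for t
    using yw[OF that] by (meson exp_ge_zero mult_right_mono order_trans)
  show "norm (y x) \<le> m * exp (?\<tau> * x)" by (rule ym[OF x])
  have "norm (y x - y 0 * cos (\<rho> * x)) \<le> norm (y x - (y 0 * cos (\<rho> * x) + y' 0 * sin (\<rho> * x) / \<rho>))
      + norm (y' 0 * sin (\<rho> * x) / \<rho>)"
    by norm
  also have "\<dots> \<le> Q * m * exp (?\<tau> * x) * a / norm \<rho> + norm (y' 0) * exp (?\<tau> * x) / norm \<rho>"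
    using sinb[of x] x unfolding norm_mult norm_divide
    by (intro add_mono bS ym divide_right_mono mult_left_mono) auto
  also have "\<dots> = (norm (y' 0) + Q * a * m) * exp (?\<tau> * x) / norm \<rho>"
    using \<rho> by (simp add: field_simps)
  finally show "norm (y x - y 0 * cos (\<rho> * x)) \<le> (norm (y' 0) + Q * a * m) * exp (?\<tau> * x) / norm \<rho>" .
  have "norm (y' x + y 0 * \<rho> * sin (\<rho> * x)) \<le>
      norm (y' x - (y' 0 * cos (\<rho> * x) - y 0 * \<rho> * sin (\<rho> * x))) + norm (y' 0 * cos (\<rho> * x))"
    by norm
  also have "norm (y' x - (y' 0 * cos (\<rho> * x) - y 0 * \<rho> * sin (\<rho> * x))) \<le> Q * m * 1 * exp (?\<tau> * x) * a"
    unfolding dC [symmetric] using cosb by (intro bnd x ym continuous_intros) auto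
  also have "norm (y' 0 * cos (\<rho> * x)) \<le> norm (y' 0) * exp (?\<tau> * x)"
    using cosb[of x] x unfolding norm_mult by (intro mult_left_mono) auto
  finally show "norm (y' x + y 0 * \<rho> * sin (\<rho> * x)) \<le> (norm (y' 0) + Q * a * m) * exp (?\<tau> * x)"
    by (simp add: algebra_simps)
qed

text \<open>The first bound keeps the two initial data apart: for \<open>\<alpha> = 0\<close> it
  gains a factor of order \<open>1 / norm \<rho>\<close>, on which the decay in Borg's theorem
  rests.\<close>

lemma sl_family_asymptotics:
  assumes "0 \<le> a" "continuous_on {0..a} q" "sl_family a q \<alpha> \<beta> Y Y'"
  obtains K R where "0 \<le> K" "1 \<le> R"
    "\<And>\<rho> x. R \<le> norm \<rho> \<Longrightarrow> x \<in> {0..a} \<Longrightarrow>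
       norm (Y (\<rho>\<^sup>2) x) \<le> 2 * (norm \<alpha> + norm \<beta> / norm \<rho>) * exp (\<bar>Im \<rho>\<bar> * x)"
    "\<And>\<rho> x. R \<le> norm \<rho> \<Longrightarrow> x \<in> {0..a} \<Longrightarrow>
       norm (Y (\<rho>\<^sup>2) x - \<alpha> * cos (\<rho> * x)) \<le> K * exp (\<bar>Im \<rho>\<bar> * x) / norm \<rho>"
    "\<And>\<rho> x. R \<le> norm \<rho> \<Longrightarrow> x \<in> {0..a} \<Longrightarrow>
       norm (Y' (\<rho>\<^sup>2) x + \<alpha> * \<rho> * sin (\<rho> * x)) \<le> K * exp (\<bar>Im \<rho>\<bar> * x)"
proof -
  obtain Q where Q: "0 \<le> Q" "\<And>x. x \<in> {0..a} \<Longrightarrow> \<bar>q x\<bar> \<le> Q"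
    using continuous_bounded_interval[OF assms(1,2)] by blast
  define K where "K = norm \<beta> + Q * a * (2 * (norm \<alpha> + norm \<beta>))"
  define R where "R = 1 + 2 * Q * a"
  have R: "\<rho> \<noteq> 0" "2 * Q * a \<le> norm \<rho>" "1 \<le> norm \<rho>" if "R \<le> norm \<rho>" for \<rho> :: complex
  proof -
    have "0 \<le> 2 * Q * a" using Q(1) \<open>0 \<le> a\<close> by simp
    with that show "2 * Q * a \<le> norm \<rho>" "1 \<le> norm \<rho>" unfolding R_def by linarith+
    then show "\<rho> \<noteq> 0" by auto
  qed
  have K: "norm \<beta> + Q * a * (2 * (norm \<alpha> + norm \<beta> / norm \<rho>)) \<le> K" if "R \<le> norm \<rho>" for \<rho> :: complex
    unfolding K_def using R[OF that] Q(1) \<open>0 \<le> a\<close>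
    by (intro add_left_mono mult_left_mono) (auto simp: divide_le_eq mult_le_cancel_left1)
  note as = sl_asymptotics[OF sl_familyD(1)[OF assms(3)] assms(1,2) Q(2) R(1,2),
      unfolded sl_familyD(2,3)[OF assms(3)]]
  show ?thesis
  proof
    show "0 \<le> K" using Q \<open>0 \<le> a\<close> by (simp add: K_def)
    show "1 \<le> R" using Q \<open>0 \<le> a\<close> by (simp add: R_def)
    fix \<rho> :: complex and x assume *: "R \<le> norm \<rho>" "x \<in> {0..a}"
    note as' = as[OF _ *(1) *(1) *(2)] and K' = K[OF *(1)]
    show "norm (Y (\<rho>\<^sup>2) x) \<le> 2 * (norm \<alpha> + norm \<beta> / norm \<rho>) * exp (\<bar>Im \<rho>\<bar> * x)"
      by (rule as'(1)) auto
    show "norm (Y (\<rho>\<^sup>2) x - \<alpha> * cos (\<rho> * x)) \<le> K * exp (\<bar>Im \<rho>\<bar> * x) / norm \<rho>"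
      by (rule order_trans[OF as'(2)], assumption, rule divide_right_mono[OF mult_right_mono[OF K']]) auto
    show "norm (Y' (\<rho>\<^sup>2) x + \<alpha> * \<rho> * sin (\<rho> * x)) \<le> K * exp (\<bar>Im \<rho>\<bar> * x)"
      by (rule order_trans[OF as'(3)], assumption, rule mult_right_mono[OF K']) auto
  qed
qed

text \<open>On the vertical sides \<open>2 * a * Re \<rho>\<close> is then an odd multiple of
  \<open>pi / 2\<close>, so the square stays away from the zeros of
  \<open>sin (2 * a * \<rho>)\<close>, hence from those of both \<open>sin (a * \<rho>)\<close> and
  \<open>cos (a * \<rho>)\<close>.\<close>

definition square_radius :: "real \<Rightarrow> nat \<Rightarrow> real" where
  "square_radius a n = pi * (real n + 1 / 2) / (2 * a)"

definition on_square :: "real \<Rightarrow> complex \<Rightarrow> bool" where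
  "on_square R \<rho> \<longleftrightarrow> max \<bar>Re \<rho>\<bar> \<bar>Im \<rho>\<bar> = R"

lemma on_square_norm: "on_square R \<rho> \<Longrightarrow> R \<le> norm \<rho>"
  using abs_Re_le_cmod[of \<rho>] abs_Im_le_cmod[of \<rho>] by (auto simp: on_square_def)

lemma square_radius_at_top:
  assumes "0 < a" shows "filterlim (square_radius a) at_top sequentially"
proof -
  have "filterlim (\<lambda>n. (pi / (2 * a)) * (1 / 2 + real n)) at_top sequentially"
    using assms
    by (intro filterlim_tendsto_pos_mult_at_top[OF tendsto_const]
        filterlim_tendsto_add_at_top[OF tendsto_const] filterlim_real_sequentially) auto
  then show ?thesis by (simp add: square_radius_def [abs_def] field_simps)
qed

text \<open>In the formula for the squared modulus the cosine term is \<open>-1\<close> on the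
  vertical sides and therefore helps. On the horizontal sides the imaginary part of the argument is
  at least \<open>pi / 2\<close> in modulus, so the exponential dominates. The constant is not meant
  to be sharp.\<close>

lemma norm_sin_on_square:
  assumes "0 < a" "on_square (square_radius a n) \<rho>"
  shows "exp (2 * a * \<bar>Im \<rho>\<bar>) / 4 \<le> norm (sin (2 * a * \<rho>))"
proof -
  let ?s = "Re (2 * a * \<rho>)" and ?t = "Im (2 * a * \<rho>)"
  have t: "2 * a * \<bar>Im \<rho>\<bar> = \<bar>?t\<bar>" using \<open>0 < a\<close> by (simp add: abs_mult)
  have N: "norm (sin (2 * a * \<rho>))^2 = (exp (2 * ?t) + inverse (exp (2 * ?t)) - 2 * cos (2 * ?s)) / 4"
    by (rule norm_sin_squared)
  have sym: "exp (2 * ?t) + inverse (exp (2 * ?t)) = exp (2 * \<bar>?t\<bar>) + exp (- 2 * \<bar>?t\<bar>)"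
    by (cases "?t \<ge> 0") (auto simp: exp_minus)
  have "(exp \<bar>?t\<bar> / 4)^2 \<le> norm (sin (2 * a * \<rho>))^2"
  proof -
    have E: "(exp \<bar>?t\<bar> / 4)^2 = exp (2 * \<bar>?t\<bar>) / 16" by (simp only: exp_double power_divide) simp
    have aux: "A / 16 \<le> (A + B - 2 * c) / 4"
      if "0 < A" "0 < B" "c = -1 \<or> 3 \<le> A \<and> c \<le> 1" for A B c :: real
      using that by auto
    consider "\<bar>Re \<rho>\<bar> = square_radius a n" | "\<bar>Im \<rho>\<bar> = square_radius a n"
      using assms(2) by (auto simp: on_square_def max_def split: if_splits)
    then show ?thesis
    proof cases
      case 1
      have "\<bar>2 * ?s\<bar> = 2 * pi * real n + pi"
        using 1 \<open>0 < a\<close> by (simp add: abs_mult square_radius_def field_simps)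
      moreover have "cos (2 * pi * real n) = 1"
        using cos_2npi[of n] by (simp add: mult_ac)
      ultimately have "cos \<bar>2 * ?s\<bar> = -1" by (simp only: cos_periodic_pi)
      then have "cos (2 * ?s) = -1" by simp
      then show ?thesis unfolding N sym E by (intro aux exp_gt_zero) simp
    next
      case 2
      have "\<bar>?t\<bar> = pi * (real n + 1 / 2)"
        unfolding t [symmetric] 2 using \<open>0 < a\<close> by (simp add: square_radius_def)
      moreover have "pi * (1 / 2) \<le> pi * (real n + 1 / 2)" by (intro mult_left_mono) auto
      ultimately have "1 \<le> \<bar>?t\<bar>" using pi_gt3 by linarith
      then have "3 \<le> exp (2 * \<bar>?t\<bar>)" using exp_ge_add_one_self[of "2 * \<bar>?t\<bar>"] by linarith
      moreover have "cos (2 * ?s) \<le> 1" by simp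
      ultimately show ?thesis unfolding N sym E by (intro aux exp_gt_zero) simp
    qed
  qed
  then show ?thesis unfolding t by (rule power2_le_imp_le) auto
qed

text \<open>Double angle formula: the lower bound for the product passes to the cosine because the
  sine is at most \<open>exp (a * \<bar>Im \<rho>\<bar>)\<close>.\<close>

lemma norm_cos_on_square:
  assumes "0 < a" "on_square (square_radius a n) \<rho>"
  shows "exp (a * \<bar>Im \<rho>\<bar>) / 8 \<le> norm (cos (\<rho> * a))"
proof -
  have "exp (2 * a * \<bar>Im \<rho>\<bar>) / 4 \<le> norm (sin (2 * (\<rho> * a)))"
    using norm_sin_on_square[OF assms] by (simp add: mult_ac)
  also have "\<dots> = 2 * norm (sin (\<rho> * a)) * norm (cos (\<rho> * a))"
    by (simp add: sin_double norm_mult)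
  also have "\<dots> \<le> 2 * exp (a * \<bar>Im \<rho>\<bar>) * norm (cos (\<rho> * a))"
    using norm_sin_le_exp[of "\<rho> * a"] \<open>0 < a\<close>
    by (intro mult_right_mono) (auto simp: abs_mult mult.commute)
  also have "exp (2 * a * \<bar>Im \<rho>\<bar>) = exp (a * \<bar>Im \<rho>\<bar>) * exp (a * \<bar>Im \<rho>\<bar>)"
    by (simp flip: exp_add)
  finally have "exp (a * \<bar>Im \<rho>\<bar>) * (exp (a * \<bar>Im \<rho>\<bar>) / 8) \<le> exp (a * \<bar>Im \<rho>\<bar>) * norm (cos (\<rho> * a))"
    by linarith
  then show ?thesis by (simp only: mult_le_cancel_left_pos exp_gt_zero)
qed

text \<open>The maximum modulus principle needs estimates on the boundaries of the squares only,
  where the trigonometric denominators are bounded below.\<close>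

lemma entire_vanishes_by_squares:
  assumes holo: "f holomorphic_on UNIV" and "0 < a"
    and bound: "\<And>n \<rho>. on_square (square_radius a n) \<rho> \<Longrightarrow> R \<le> norm \<rho> \<Longrightarrow> norm (f \<rho>) \<le> C / norm \<rho>"
  shows "f z = 0"
proof -
  let ?r = "square_radius a"
  have lim: "(\<lambda>n. \<bar>C\<bar> / ?r n) \<longlonglongrightarrow> 0"
    by (intro tendsto_divide_0[OF tendsto_const] filterlim_at_top_imp_at_infinity
        square_radius_at_top \<open>0 < a\<close>)
  have "\<forall>\<^sub>F n in sequentially. max (max R 1) (norm z + 1) \<le> ?r n"
    using square_radius_at_top[OF \<open>0 < a\<close>] unfolding filterlim_at_top by blast
  then have "\<forall>\<^sub>F n in sequentially. norm (f z) \<le> \<bar>C\<bar> / ?r n"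
  proof eventually_elim
    case (elim n)
    let ?r = "square_radius a n"
    let ?S = "cbox (Complex (- ?r) (- ?r)) (Complex ?r ?r)"
    show ?case
    proof (rule maximum_modulus_frontier[of f ?S])
      show "f holomorphic_on interior ?S" by (rule holomorphic_on_subset[OF holo]) auto
      show "continuous_on (closure ?S) f"
        by (rule continuous_on_subset[OF holomorphic_on_imp_continuous_on[OF holo]]) auto
      show "z \<in> ?S"
        using abs_Re_le_cmod[of z] abs_Im_le_cmod[of z] elim by (auto simp: in_cbox_complex_iff)
      fix \<rho> assume "\<rho> \<in> frontier ?S"
      then have "\<rho> \<in> ?S" "\<rho> \<notin> box (Complex (- ?r) (- ?r)) (Complex ?r ?r)"
        by (simp_all add: frontier_def)
      then have sq: "on_square ?r \<rho>"
        by (auto simp: in_cbox_complex_iff in_box_complex_iff on_square_def max_def)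
      have "?r \<le> norm \<rho>" by (rule on_square_norm[OF sq])
      then have "norm (f \<rho>) \<le> C / norm \<rho>" using elim by (intro bound[OF sq]) auto
      also have "\<dots> \<le> \<bar>C\<bar> / ?r"
        using \<open>?r \<le> norm \<rho>\<close> elim by (intro frac_le) auto
      finally show "norm (f \<rho>) \<le> \<bar>C\<bar> / ?r" .
    qed auto
  qed
  then have "norm (f z) \<le> 0"
    by (intro tendsto_lowerbound[OF lim]) auto
  then show ?thesis by simp
qed

section \<open>Borg's uniqueness theorem\<close>

lemma vector_derivative_eq_on:
  fixes f g :: "real \<Rightarrow> complex"
  assumes "0 < a" "x \<in> {0..a}" and eq: "\<And>t. t \<in> {0..a} \<Longrightarrow> f t = g t"
    and "(f has_vector_derivative f') (at x within {0..a})"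
    and "(g has_vector_derivative g') (at x within {0..a})"
  shows "f' = g'"
proof -
  have "(f has_vector_derivative g') (at x within {0..a})"
    using has_vector_derivative_transform[OF assms(2) eq assms(5)] .
  then show ?thesis
    using vector_derivative_unique_within_closed_interval[of 0 a x f f' g'] assms by simp
qed

text \<open>Working in \<open>\<rho>\<close> with \<open>\<mu> = \<rho>\<^sup>2\<close> keeps
  everything entire without a branch of the root on the contours; \<open>csqrt\<close> appears only
  to return to a given \<open>\<mu>\<close>.\<close>

lemma entire_compose_square:
  assumes "f holomorphic_on UNIV"
  shows "(\<lambda>\<rho>::complex. f (\<rho>\<^sup>2)) holomorphic_on UNIV"
proof -
  have "(\<lambda>\<rho>::complex. \<rho>\<^sup>2) holomorphic_on UNIV" by (intro holomorphic_on_power holomorphic_on_ident)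
  from holomorphic_on_compose[OF this holomorphic_on_subset[OF assms]]
  show ?thesis by (simp add: o_def)
qed

text \<open>For \<open>norm \<rho> \<ge> 16 * K\<close> the error consumes at most half of the lower
  bound 1/8 for the cosine.\<close>

lemma sl_family_lower_on_square:
  assumes "0 < a" "continuous_on {0..a} q" "sl_family a q 1 \<beta> Y Y'"
  obtains R where "1 \<le> R" "\<And>n \<rho>. on_square (square_radius a n) \<rho> \<Longrightarrow> R \<le> norm \<rho> \<Longrightarrow>
    exp (\<bar>Im \<rho>\<bar> * a) / 16 \<le> norm (Y (\<rho>\<^sup>2) a)"
proof -
  have a: "0 \<le> a" using \<open>0 < a\<close> by simp
  obtain K R where K: "0 \<le> K" "1 \<le> R"
    "\<And>\<rho> x. R \<le> norm \<rho> \<Longrightarrow> x \<in> {0..a} \<Longrightarrow>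
       norm (Y (\<rho>\<^sup>2) x - 1 * cos (\<rho> * x)) \<le> K * exp (\<bar>Im \<rho>\<bar> * x) / norm \<rho>"
    using sl_family_asymptotics[OF a assms(2,3)] by metis
  show ?thesis
  proof
    show "1 \<le> max R (16 * K)" using K by simp
    fix n \<rho> assume sq: "on_square (square_radius a n) \<rho>" and r: "max R (16 * K) \<le> norm \<rho>"
    let ?e = "exp (\<bar>Im \<rho>\<bar> * a)"
    have "norm (Y (\<rho>\<^sup>2) a - cos (\<rho> * a)) \<le> K * ?e / norm \<rho>"
      using K(3)[of \<rho> a] r a by simp
    also have "\<dots> \<le> ?e / 16"
      using r K(2) by (simp add: divide_le_eq)
    finally have "norm (cos (\<rho> * a)) - ?e / 16 \<le> norm (Y (\<rho>\<^sup>2) a)" by norm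
    then show "?e / 16 \<le> norm (Y (\<rho>\<^sup>2) a)"
      using norm_cos_on_square[OF \<open>0 < a\<close> sq] by (simp add: mult.commute)
  qed
qed

text \<open>Seen from the endpoint \<open>a\<close>, the hypothesis says that the two Weyl functions agree.
  Let \<open>C\<close>, \<open>S\<close> and \<open>Ct\<close>, \<open>St\<close> be the fundamental systems at \<open>a\<close>. Then the entire function
  \<open>S * Ct - St * C\<close> can be rewritten with the decaying quotients \<open>Y (a - x) / Y a\<close>, so it is
  small on large squares and vanishes; hence \<open>C\<^sup>2 = Ct\<^sup>2\<close>.\<close>

lemma borg_uniqueness:
  assumes "0 < a" and q: "continuous_on {0..a} q" and qt: "continuous_on {0..a} qt"
    and Y: "sl_family a q 1 \<beta> Y Y'" and Z: "sl_family a qt 1 \<gamma> Z Z'"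
    and eq: "\<And>\<mu>. Y' \<mu> a * Z \<mu> a = Z' \<mu> a * Y \<mu> a"
    and x: "x \<in> {0..a}"
  shows "q x = qt x"
proof -
  have a: "0 \<le> a" using \<open>0 < a\<close> by simp
  define r where "r x = q (a - x)" for x
  define rt where "rt x = qt (a - x)" for x
  have r: "continuous_on {0..a} r" and rt: "continuous_on {0..a} rt"
    unfolding r_def rt_def by (auto intro!: continuous_on_compose2[OF q] continuous_on_compose2[OF qt] continuous_intros)
  obtain C C' where C: "sl_family a r 1 0 C C'" using sl_family_exists[OF a r] .
  obtain S S' where S: "sl_family a r 0 1 S S'" using sl_family_exists[OF a r] .
  obtain Ct Ct' where Ct: "sl_family a rt 1 0 Ct Ct'" using sl_family_exists[OF a rt] .
  obtain St St' where St: "sl_family a rt 0 1 St St'" using sl_family_exists[OF a rt] .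
  \<comment> \<open>The minus sign comes from the reflection, which reverses the derivative.\<close>
  have Yr: "Y \<mu> (a - x) = Y \<mu> a * C \<mu> x - Y' \<mu> a * S \<mu> x" if "x \<in> {0..a}" for \<mu> x
    using ode_sol_decompose(1)[OF ode_sol_reflect[OF sl_familyD(1)[OF Y, of \<mu>]]
        sl_familyD(1)[OF C, of \<mu>, unfolded r_def] sl_familyD(1)[OF S, of \<mu>, unfolded r_def] _ _ _ _ that]
      sl_familyD(2,3)[OF C] sl_familyD(2,3)[OF S] by simp
  have Zr: "Z \<mu> (a - x) = Z \<mu> a * Ct \<mu> x - Z' \<mu> a * St \<mu> x" if "x \<in> {0..a}" for \<mu> x
    using ode_sol_decompose(1)[OF ode_sol_reflect[OF sl_familyD(1)[OF Z, of \<mu>]]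
        sl_familyD(1)[OF Ct, of \<mu>, unfolded rt_def] sl_familyD(1)[OF St, of \<mu>, unfolded rt_def] _ _ _ _ that]
      sl_familyD(2,3)[OF Ct] sl_familyD(2,3)[OF St] by simp
  define G where "G x \<mu> = S \<mu> x * Ct \<mu> x - St \<mu> x * C \<mu> x" for x \<mu>
  \<comment> \<open>Expanding the right side leaves, besides the term with \<open>G\<close>, a
    multiple of \<open>S * St\<close> by the difference of the Weyl data, which vanishes by
    \<open>eq\<close>.\<close>
  have G_id: "Y \<mu> a * Z \<mu> a * G x \<mu> = S \<mu> x * Z \<mu> (a - x) * Y \<mu> a - St \<mu> x * Y \<mu> (a - x) * Z \<mu> a"
    if "x \<in> {0..a}" for x \<mu>
  proof -
    have "S \<mu> x * Z \<mu> (a - x) * Y \<mu> a - St \<mu> x * Y \<mu> (a - x) * Z \<mu> a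
        = Y \<mu> a * Z \<mu> a * G x \<mu> + S \<mu> x * St \<mu> x * (Y' \<mu> a * Z \<mu> a - Z' \<mu> a * Y \<mu> a)"
      unfolding Yr[OF that] Zr[OF that] G_def by (simp add: algebra_simps)
    then show ?thesis by (simp add: eq)
  qed
  obtain RY where RY: "1 \<le> RY" "\<And>\<rho> x. RY \<le> norm \<rho> \<Longrightarrow> x \<in> {0..a} \<Longrightarrow>
       norm (Y (\<rho>\<^sup>2) x) \<le> 2 * (norm (1::complex) + norm \<beta> / norm \<rho>) * exp (\<bar>Im \<rho>\<bar> * x)"
    using sl_family_asymptotics[OF a q Y] by metis
  obtain RZ where RZ: "1 \<le> RZ" "\<And>\<rho> x. RZ \<le> norm \<rho> \<Longrightarrow> x \<in> {0..a} \<Longrightarrow>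
       norm (Z (\<rho>\<^sup>2) x) \<le> 2 * (norm (1::complex) + norm \<gamma> / norm \<rho>) * exp (\<bar>Im \<rho>\<bar> * x)"
    using sl_family_asymptotics[OF a qt Z] by metis
  obtain RS where RS: "1 \<le> RS" "\<And>\<rho> x. RS \<le> norm \<rho> \<Longrightarrow> x \<in> {0..a} \<Longrightarrow>
       norm (S (\<rho>\<^sup>2) x) \<le> 2 * (norm (0::complex) + norm (1::complex) / norm \<rho>) * exp (\<bar>Im \<rho>\<bar> * x)"
    using sl_family_asymptotics[OF a r S] by metis
  obtain RT where RT: "1 \<le> RT" "\<And>\<rho> x. RT \<le> norm \<rho> \<Longrightarrow> x \<in> {0..a} \<Longrightarrow>
       norm (St (\<rho>\<^sup>2) x) \<le> 2 * (norm (0::complex) + norm (1::complex) / norm \<rho>) * exp (\<bar>Im \<rho>\<bar> * x)"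
    using sl_family_asymptotics[OF a rt St] by metis
  obtain LY where LY: "1 \<le> LY" "\<And>n \<rho>. on_square (square_radius a n) \<rho> \<Longrightarrow> LY \<le> norm \<rho> \<Longrightarrow>
    exp (\<bar>Im \<rho>\<bar> * a) / 16 \<le> norm (Y (\<rho>\<^sup>2) a)"
    using sl_family_lower_on_square[OF \<open>0 < a\<close> q Y] by metis
  obtain LZ where LZ: "1 \<le> LZ" "\<And>n \<rho>. on_square (square_radius a n) \<rho> \<Longrightarrow> LZ \<le> norm \<rho> \<Longrightarrow>
    exp (\<bar>Im \<rho>\<bar> * a) / 16 \<le> norm (Z (\<rho>\<^sup>2) a)"
    using sl_family_lower_on_square[OF \<open>0 < a\<close> qt Z] by metis
  have G0: "G x \<mu> = 0" if x: "x \<in> {0..a}" for x \<mu>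
  proof -
    have holo: "G x holomorphic_on UNIV"
      unfolding G_def
      by (intro holomorphic_intros sl_family_holomorphic(1)[OF a r C x] sl_family_holomorphic(1)[OF a r S x]
          sl_family_holomorphic(1)[OF a rt Ct x] sl_family_holomorphic(1)[OF a rt St x])
    have "G x ((csqrt \<mu>)\<^sup>2) = 0"
    proof (rule entire_vanishes_by_squares[OF entire_compose_square[OF holo] \<open>0 < a\<close>, where R = "Max {RY, RZ, RS, RT, LY, LZ}"])
      fix n \<rho> assume sq: "on_square (square_radius a n) \<rho>" and "Max {RY, RZ, RS, RT, LY, LZ} \<le> norm \<rho>"
      then have big: "RY \<le> norm \<rho>" "RZ \<le> norm \<rho>" "RS \<le> norm \<rho>" "RT \<le> norm \<rho>" "LY \<le> norm \<rho>" "LZ \<le> norm \<rho>"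
        by auto
      have \<rho>1: "1 \<le> norm \<rho>" using big(1) RY(1) by linarith
      let ?\<tau> = "\<bar>Im \<rho>\<bar>"
      let ?\<mu> = "\<rho>\<^sup>2"
      have xa: "a - x \<in> {0..a}" using x by auto
      \<comment> \<open>The growth rates over \<open>x\<close> and \<open>a - x\<close> add up to
        that over \<open>a\<close> and cancel against the lower bound; the remaining
        \<open>1 / norm \<rho>\<close> comes from the zero initial value of \<open>s\<close>. The
        constant is 64 = 4 * 16.\<close>
      have quot: "norm s * norm y \<le> (64 * (1 + norm b) / norm \<rho>) * norm w"
        if s: "norm s \<le> 2 * (norm (0::complex) + norm (1::complex) / norm \<rho>) * exp (?\<tau> * x)"
          and y: "norm y \<le> 2 * (norm (1::complex) + norm b / norm \<rho>) * exp (?\<tau> * (a - x))"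
          and w: "exp (?\<tau> * a) / 16 \<le> norm w" for s y w b :: complex
      proof -
        have "norm s * norm y \<le> (2 * (norm (0::complex) + norm (1::complex) / norm \<rho>) * exp (?\<tau> * x))
            * (2 * (norm (1::complex) + norm b / norm \<rho>) * exp (?\<tau> * (a - x)))"
          by (intro mult_mono s y) auto
        also have "\<dots> = (4 / norm \<rho>) * (1 + norm b / norm \<rho>) * exp (?\<tau> * a)"
          by (simp add: exp_add [symmetric] field_simps)
        also have "\<dots> \<le> (4 / norm \<rho>) * (1 + norm b) * (16 * norm w)"
          using \<rho>1 w by (intro mult_mono) (auto simp: divide_le_eq mult_le_cancel_left1)
        also have "\<dots> = (64 * (1 + norm b) / norm \<rho>) * norm w"
          by (simp add: algebra_simps)
        finally show ?thesis .
      qed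
      have pos: "0 < norm (Y ?\<mu> a)" "0 < norm (Z ?\<mu> a)"
        using LY(2)[OF sq big(5)] LZ(2)[OF sq big(6)] by (smt (verit) divide_pos_pos exp_gt_zero)+
      have t1: "norm (S ?\<mu> x) * norm (Z ?\<mu> (a - x)) \<le> (64 * (1 + norm \<gamma>) / norm \<rho>) * norm (Z ?\<mu> a)"
        by (rule quot[OF RS(2)[OF big(3) x] RZ(2)[OF big(2) xa] LZ(2)[OF sq big(6)]])
      have t2: "norm (St ?\<mu> x) * norm (Y ?\<mu> (a - x)) \<le> (64 * (1 + norm \<beta>) / norm \<rho>) * norm (Y ?\<mu> a)"
        by (rule quot[OF RT(2)[OF big(4) x] RY(2)[OF big(1) xa] LY(2)[OF sq big(5)]])
      have "(norm (Y ?\<mu> a) * norm (Z ?\<mu> a)) * norm (G x ?\<mu>) =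
          norm (S ?\<mu> x * Z ?\<mu> (a - x) * Y ?\<mu> a - St ?\<mu> x * Y ?\<mu> (a - x) * Z ?\<mu> a)"
        by (simp only: G_id[OF x, symmetric] norm_mult)
      also have "\<dots> \<le> (norm (S ?\<mu> x) * norm (Z ?\<mu> (a - x))) * norm (Y ?\<mu> a)
          + (norm (St ?\<mu> x) * norm (Y ?\<mu> (a - x))) * norm (Z ?\<mu> a)"
        by (rule order_trans[OF norm_triangle_ineq4]) (simp add: norm_mult)
      also have "\<dots> \<le> (64 * (1 + norm \<gamma>) / norm \<rho>) * norm (Z ?\<mu> a) * norm (Y ?\<mu> a)
          + (64 * (1 + norm \<beta>) / norm \<rho>) * norm (Y ?\<mu> a) * norm (Z ?\<mu> a)"
        by (intro add_mono mult_right_mono t1 t2) auto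
      also have "\<dots> = (norm (Y ?\<mu> a) * norm (Z ?\<mu> a)) * ((64 * (1 + norm \<gamma>) + 64 * (1 + norm \<beta>)) / norm \<rho>)"
        by (simp add: add_divide_distrib algebra_simps)
      finally show "norm (G x ?\<mu>) \<le> (64 * (1 + norm \<gamma>) + 64 * (1 + norm \<beta>)) / norm \<rho>"
        using pos by (simp only: mult_le_cancel_left_pos mult_pos_pos)
    qed
    then show ?thesis by simp
  qed
  obtain K R where K: "0 \<le> K" "1 \<le> R"
    "\<And>\<rho> x. R \<le> norm \<rho> \<Longrightarrow> x \<in> {0..a} \<Longrightarrow>
       norm (C (\<rho>\<^sup>2) x - 1 * cos (\<rho> * x)) \<le> K * exp (\<bar>Im \<rho>\<bar> * x) / norm \<rho>"
    using sl_family_asymptotics[OF a r C] by metis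
  obtain Kt Rt where Kt: "0 \<le> Kt" "1 \<le> Rt"
    "\<And>\<rho> x. Rt \<le> norm \<rho> \<Longrightarrow> x \<in> {0..a} \<Longrightarrow>
       norm (Ct (\<rho>\<^sup>2) x - 1 * cos (\<rho> * x)) \<le> Kt * exp (\<bar>Im \<rho>\<bar> * x) / norm \<rho>"
    using sl_family_asymptotics[OF a rt Ct] by metis
  define k where "k = max R Rt + 2 * K + 2 * Kt"
  have k: "R \<le> k" "Rt \<le> k" "2 * K < k" "2 * Kt < k" "0 < k"
    using K(1,2) Kt(1,2) by (auto simp: k_def max_def)
  \<comment> \<open>From here one parameter suffices, \<open>\<mu> = - k\<^sup>2\<close>, with
    \<open>k\<close> so large that \<open>C\<close> and \<open>Ct\<close> follow
    \<open>cosh (k * t)\<close> closely enough to have positive real part. This excludes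
    \<open>Ct = - C\<close> and permits division by \<open>C\<close>.\<close>
  define \<mu> where "\<mu> = (\<i> * complex_of_real k)\<^sup>2"
  have re_pos: "0 < Re w"
    if w: "norm (w - 1 * cos (\<i> * complex_of_real k * of_real t))
        \<le> L * exp (\<bar>Im (\<i> * complex_of_real k)\<bar> * t) / norm (\<i> * complex_of_real k)"
      and L: "2 * L < k" for w t L
  proof -
    have "cos (\<i> * complex_of_real k * of_real t) = of_real ((exp (k * t) + exp (- (k * t))) / 2)"
      by (simp add: cos_exp_eq exp_of_real [symmetric] algebra_simps)
    then have "Re (w - cos (\<i> * complex_of_real k * of_real t)) = Re w - (exp (k * t) + exp (- (k * t))) / 2"
      by (simp only: minus_complex.sel Re_complex_of_real)
    moreover have "norm (w - cos (\<i> * complex_of_real k * of_real t)) \<le> L * exp (k * t) / k"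
      using w k(5) by (simp add: norm_mult)
    ultimately have "\<bar>Re w - (exp (k * t) + exp (- (k * t))) / 2\<bar> \<le> L * exp (k * t) / k"
      using abs_Re_le_cmod[of "w - cos (\<i> * complex_of_real k * of_real t)"]
      by (metis order_trans)
    moreover have "L * exp (k * t) / k \<le> exp (k * t) / 2"
      using L k(5) by (simp add: field_simps)
    moreover have "0 < exp (- (k * t))" by simp
    moreover have "0 < v" if "\<bar>v - (e + e') / 2\<bar> \<le> b" "b \<le> e / 2" "0 < e'" for v e e' b :: real
      using that unfolding abs_le_iff by (simp add: add_divide_distrib)
    ultimately show ?thesis by blast
  qed
  have C_pos: "0 < Re (C \<mu> t)" and Ct_pos: "0 < Re (Ct \<mu> t)" if "t \<in> {0..a}" for t
    using re_pos[OF K(3)[of "\<i> * complex_of_real k" t] k(3)]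
      re_pos[OF Kt(3)[of "\<i> * complex_of_real k" t] k(4)] k that
    unfolding \<mu>_def by (auto simp: norm_mult)
  note ode = sl_familyD(1)[OF C, of \<mu>] sl_familyD(1)[OF S, of \<mu>]
    sl_familyD(1)[OF Ct, of \<mu>] sl_familyD(1)[OF St, of \<mu>]
  \<comment> \<open>Multiplying the derivative of \<open>G = 0\<close> by \<open>C * Ct\<close> and
    inserting both Wronskians leaves \<open>Ct\<^sup>2 - C\<^sup>2\<close>; the other terms cancel
    by \<open>G = 0\<close> itself.\<close>
  have CCt: "C \<mu> t = Ct \<mu> t" if t: "t \<in> {0..a}" for t
  proof -
    have "S' \<mu> t * Ct \<mu> t + S \<mu> t * Ct' \<mu> t - (St' \<mu> t * C \<mu> t + St \<mu> t * C' \<mu> t) = 0"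
    proof (rule vector_derivative_eq_on[OF \<open>0 < a\<close> t, of "\<lambda>t. S \<mu> t * Ct \<mu> t - St \<mu> t * C \<mu> t" "\<lambda>_. 0"])
      show "((\<lambda>t. S \<mu> t * Ct \<mu> t - St \<mu> t * C \<mu> t) has_vector_derivative
          S' \<mu> t * Ct \<mu> t + S \<mu> t * Ct' \<mu> t - (St' \<mu> t * C \<mu> t + St \<mu> t * C' \<mu> t)) (at t within {0..a})"
        using ode t unfolding ode_sol_def by (auto intro!: derivative_eq_intros simp: algebra_simps)
    qed (use G0 in \<open>auto simp: G_def\<close>)
    moreover have "S \<mu> t * Ct \<mu> t = St \<mu> t * C \<mu> t" using G0[OF t, of \<mu>] by (simp add: G_def)
    moreover have "S' \<mu> t * C \<mu> t = 1 + S \<mu> t * C' \<mu> t"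
      using ode_sol_wronskian[OF ode(2) ode(1) t] sl_familyD(2,3)[OF C] sl_familyD(2,3)[OF S]
      by (simp add: algebra_simps)
    moreover have "St' \<mu> t * Ct \<mu> t = 1 + St \<mu> t * Ct' \<mu> t"
      using ode_sol_wronskian[OF ode(4) ode(3) t] sl_familyD(2,3)[OF Ct] sl_familyD(2,3)[OF St]
      by (simp add: algebra_simps)
    ultimately have "(Ct \<mu> t - C \<mu> t) * (Ct \<mu> t + C \<mu> t) = 0" by algebra
    moreover have "Ct \<mu> t + C \<mu> t \<noteq> 0"
      using C_pos[OF t] Ct_pos[OF t] by (auto simp: complex_eq_iff)
    ultimately show ?thesis by simp
  qed
  have CCt': "C' \<mu> t = Ct' \<mu> t" if t: "t \<in> {0..a}" for t
    by (rule vector_derivative_eq_on[OF \<open>0 < a\<close> t, of "C \<mu>" "Ct \<mu>"])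
      (use CCt ode(1,3) t in \<open>auto simp: ode_sol_def\<close>)
  have rr: "r t = rt t" if t: "t \<in> {0..a}" for t
  proof -
    have "(of_real (r t) - \<mu>) * C \<mu> t = (of_real (rt t) - \<mu>) * Ct \<mu> t"
      by (rule vector_derivative_eq_on[OF \<open>0 < a\<close> t, of "C' \<mu>" "Ct' \<mu>"])
        (use CCt' ode(1,3) t in \<open>auto simp: ode_sol_def\<close>)
    then show ?thesis using C_pos[OF t] CCt[OF t] by auto
  qed
  show ?thesis using rr[of "a - x"] x by (auto simp: r_def rt_def)
qed

section \<open>Herglotz property and entire quotients\<close>

lemma ode_sol_cnj:
  assumes "ode_sol a (\<lambda>x. of_real (q x) - \<mu>) y y'"
  shows "ode_sol a (\<lambda>x. of_real (q x) - cnj \<mu>) (\<lambda>x. cnj (y x)) (\<lambda>x. cnj (y' x))"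
  unfolding ode_sol_def
proof (intro ballI conjI)
  fix x assume x: "x \<in> {0..a}"
  have y: "(y has_vector_derivative y' x) (at x within {0..a})"
    and y': "(y' has_vector_derivative (of_real (q x) - \<mu>) * y x) (at x within {0..a})"
    using assms x by (auto simp: ode_sol_def)
  show "((\<lambda>x. cnj (y x)) has_vector_derivative cnj (y' x)) (at x within {0..a})"
    by (rule has_vector_derivative_cnj[OF y])
  show "((\<lambda>x. cnj (y' x)) has_vector_derivative (of_real (q x) - cnj \<mu>) * cnj (y x)) (at x within {0..a})"
    using has_vector_derivative_cnj[OF y'] by simp
qed

text \<open>Up to sign, the logarithmic derivative of a solution with real initial data is a
  Herglotz function of the spectral parameter.\<close>

lemma sl_family_herglotz:
  assumes "0 \<le> a" "sl_family a q 1 (of_real h) Y Y'"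
  shows "Im (Y' \<mu> a * cnj (Y \<mu> a)) = - Im \<mu> * integral {0..a} (\<lambda>x. (norm (Y \<mu> x))\<^sup>2)"
proof -
  note fam = sl_familyD[OF assms(2)]
  have "((\<lambda>t. - 2 * \<i> * of_real (Im \<mu>) * of_real ((norm (Y \<mu> t))\<^sup>2)) has_integral
      Y' \<mu> a * cnj (Y \<mu> a) - Y \<mu> a * cnj (Y' \<mu> a)) {0..a}"
  proof -
    have "(of_real (q t) - \<mu> - (of_real (q t) - cnj \<mu>)) * (Y \<mu> t * cnj (Y \<mu> t))
        = - 2 * \<i> * of_real (Im \<mu>) * of_real ((norm (Y \<mu> t))\<^sup>2)" for t
      by (subst complex_norm_square) (simp add: complex_eq_iff)
    then show ?thesis
      using ode_sol_lagrange[OF fam(1)[of \<mu>] ode_sol_cnj[OF fam(1)[of \<mu>]], of a] fam(2,3)[of \<mu>] \<open>0 \<le> a\<close>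
      by simp
  qed
  from has_integral_linear[OF this bounded_linear_Im]
  have "((\<lambda>t. - 2 * Im \<mu> * (norm (Y \<mu> t))\<^sup>2) has_integral 2 * Im (Y' \<mu> a * cnj (Y \<mu> a))) {0..a}"
    by (simp add: o_def algebra_simps)
  then have "integral {0..a} (\<lambda>t. - 2 * Im \<mu> * (norm (Y \<mu> t))\<^sup>2) = 2 * Im (Y' \<mu> a * cnj (Y \<mu> a))"
    by (rule integral_unique)
  then show ?thesis by simp
qed

text \<open>All members start at the value 1 and leave it at a speed bounded uniformly for
  \<open>norm \<mu> \<le> M\<close>, so they stay above 1/2 in modulus on a common initial interval.
  This uniformity makes the Herglotz identity quantitative.\<close>

lemma sl_family_integral_lower:
  assumes "0 < a" "continuous_on {0..a} q" "sl_family a q 1 \<beta> Y Y'"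
  obtains n0 where "0 < n0" "\<And>\<mu>. norm \<mu> \<le> M \<Longrightarrow> n0 \<le> integral {0..a} (\<lambda>x. (norm (Y \<mu> x))\<^sup>2)"
proof -
  have a: "0 \<le> a" using \<open>0 < a\<close> by simp
  note fam = sl_familyD[OF assms(3)]
  obtain Q where Q: "0 \<le> Q" "\<And>x. x \<in> {0..a} \<Longrightarrow> \<bar>q x\<bar> \<le> Q"
    using continuous_bounded_interval[OF a assms(2)] by blast
  obtain B where B: "0 \<le> B" "\<And>\<mu> x. norm \<mu> \<le> M \<Longrightarrow> x \<in> {0..a} \<Longrightarrow> norm (Y \<mu> x) \<le> B"
    using sl_family_bounded[OF a assms(2,3)] by metis
  define L where "L = 1 + norm \<beta> + (Q + \<bar>M\<bar>) * B * a"
  have L: "1 \<le> L" using Q B a by (simp add: L_def)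
  define x0 where "x0 = min a (1 / (2 * L))"
  have x0: "0 < x0" "x0 \<le> a" "L * x0 \<le> 1 / 2"
  proof -
    show "0 < x0" "x0 \<le> a" using L \<open>0 < a\<close> by (auto simp: x0_def)
    have "L * x0 \<le> L * (1 / (2 * L))" using L by (intro mult_left_mono) (auto simp: x0_def)
    then show "L * x0 \<le> 1 / 2" using L by simp
  qed
  have "x0 / 4 \<le> integral {0..a} (\<lambda>x. (norm (Y \<mu> x))\<^sup>2)" if \<mu>: "norm \<mu> \<le> M" for \<mu>
  proof -
    have cont: "continuous_on {0..a} (Y \<mu>)" using ode_sol_continuous(1)[OF fam(1)] .
    have half: "1 / 2 \<le> norm (Y \<mu> x)" if x: "x \<in> {0..x0}" for x
    proof -
      have xa: "x \<in> {0..a}" using x x0(2) by auto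
      \<comment> \<open>Lagrange's identity against the solution \<open>x - t\<close> of
        \<open>z'' = 0\<close> is Taylor's formula with integral remainder.\<close>
      have "ode_sol a (\<lambda>_. 0) (\<lambda>t. of_real (x - t)) (\<lambda>_. -1)"
        unfolding ode_sol_def by (auto intro!: derivative_eq_intros)
      from ode_sol_lagrange[OF fam(1)[of \<mu>] this xa]
      have "integral {0..x} (\<lambda>t. (of_real (q t) - \<mu>) * (Y \<mu> t * of_real (x - t))) = Y \<mu> x - (1 + \<beta> * of_real x)"
        using fam(2,3)[of \<mu>] by (intro integral_unique) (simp add: algebra_simps)
      moreover have "norm (integral {0..x} (\<lambda>t. (of_real (q t) - \<mu>) * (Y \<mu> t * of_real (x - t))))
          \<le> ((Q + \<bar>M\<bar>) * (B * a)) * (x - 0)"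
      proof (rule integral_bound)
        show "continuous_on {0..x} (\<lambda>t. (of_real (q t) - \<mu>) * (Y \<mu> t * of_real (x - t)))"
          using xa by (intro continuous_intros continuous_on_subset[OF assms(2)] continuous_on_subset[OF cont]) auto
        fix t assume t: "t \<in> {0..x}"
        have "norm (complex_of_real (q t) - \<mu>) \<le> Q + \<bar>M\<bar>"
          using Q(2)[of t] t xa \<mu> norm_triangle_ineq4[of "complex_of_real (q t)" \<mu>] by auto
        moreover have "norm (Y \<mu> t) \<le> B" using B(2)[OF \<mu>, of t] t xa by auto
        moreover have "norm (complex_of_real (x - t)) \<le> a" using t xa by (simp del: of_real_diff)
        ultimately show "norm ((complex_of_real (q t) - \<mu>) * (Y \<mu> t * of_real (x - t))) \<le> (Q + \<bar>M\<bar>) * (B * a)"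
          unfolding norm_mult using Q(1) B(1) by (intro mult_mono) auto
      qed (use xa in auto)
      ultimately have "norm (Y \<mu> x - (1 + \<beta> * of_real x)) \<le> (Q + \<bar>M\<bar>) * B * a * x" by (simp add: mult.assoc)
      moreover have "norm (Y \<mu> x - 1) \<le> norm (Y \<mu> x - (1 + \<beta> * of_real x)) + norm (\<beta> * of_real x)" by norm
      moreover have "norm (\<beta> * complex_of_real x) = norm \<beta> * x" using x by (simp add: norm_mult)
      ultimately have "norm (Y \<mu> x - 1) \<le> (L - 1) * x" by (simp add: L_def algebra_simps)
      also have "\<dots> \<le> L * x0" using x L by (intro mult_mono) auto
      finally have "norm (Y \<mu> x - 1) \<le> 1 / 2" using x0(3) by linarith
      then show ?thesis using norm_triangle_ineq2[of 1 "1 - Y \<mu> x"] by (simp add: norm_minus_commute)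
    qed
    have int: "(\<lambda>x. (norm (Y \<mu> x))\<^sup>2) integrable_on {0..a}"
      by (intro integrable_continuous_real continuous_intros cont)
    have int0: "(\<lambda>x. (norm (Y \<mu> x))\<^sup>2) integrable_on {0..x0}"
      using x0 by (intro integrable_continuous_real continuous_intros continuous_on_subset[OF cont]) auto
    have "x0 / 4 = integral {0..x0} (\<lambda>_. (1 / 2)\<^sup>2 :: real)"
      using x0 by (simp add: power2_eq_square)
    also have "\<dots> \<le> integral {0..x0} (\<lambda>x. (norm (Y \<mu> x))\<^sup>2)"
      by (intro integral_le int0 integrable_const_ivl power_mono half) auto
    also have "\<dots> \<le> integral {0..a} (\<lambda>x. (norm (Y \<mu> x))\<^sup>2)"
      using x0 by (intro integral_subset_le int int0) auto
    finally show ?thesis .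
  qed
  then show ?thesis using that[of "x0 / 4"] x0(1) by simp
qed

text \<open>Near a zero of \<open>D\<close> both functions are divided by \<open>w - z\<close>
  first: the two difference quotients are entire, and the lower one is nonzero at \<open>z\<close>
  because the zero is simple.\<close>

lemma entire_quotient:
  assumes F: "F holomorphic_on UNIV" and D: "D holomorphic_on UNIV"
    and zeros: "\<And>z. D z = 0 \<Longrightarrow> F z = 0 \<and> deriv D z \<noteq> 0"
  obtains g where "g holomorphic_on UNIV" "\<And>z. F z = g z * D z"
proof -
  define g where "g z = (if D z = 0 then deriv F z / deriv D z else F z / D z)" for z
  have "g field_differentiable at z" for z
  proof -
    define F1 where "F1 w = (if w = z then deriv F z else (F w - F z) / (w - z))" for w
    define D1 where "D1 w = (if w = z then deriv D z else (D w - D z) / (w - z))" for w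
    have F1: "F1 holomorphic_on UNIV" unfolding F1_def by (rule pole_lemma[OF F]) simp
    have D1: "D1 holomorphic_on UNIV" unfolding D1_def by (rule pole_lemma[OF D]) simp
    have diff: "f field_differentiable at z" if "f holomorphic_on UNIV" for f
      using that by (simp add: holomorphic_on_def)
    have nhd: "\<exists>e>0. \<forall>w\<in>ball z e. f w \<noteq> 0" if "f holomorphic_on UNIV" "f z \<noteq> 0" for f
    proof -
      have "isCont f z"
        using holomorphic_on_imp_continuous_on[OF that(1)] by (simp add: continuous_on_eq_continuous_at)
      then show ?thesis using continuous_at_avoid[of z f 0] that(2) by (auto simp: dist_commute)
    qed
    show ?thesis
    proof (cases "D z = 0")
      case True
      then have "D1 z \<noteq> 0" using zeros[of z] by (simp add: D1_def)
      then obtain e where e: "0 < e" "\<forall>w\<in>ball z e. D1 w \<noteq> 0" using nhd[OF D1] by blast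
      have eq: "F1 w / D1 w = g w" if w: "dist w z < e" for w
      proof (cases "w = z")
        case True
        then show ?thesis using \<open>D z = 0\<close> by (simp add: F1_def D1_def g_def)
      next
        case False
        have "D1 w \<noteq> 0" using e(2) w by (simp add: dist_commute)
        then show ?thesis using \<open>D z = 0\<close> zeros[of z] False
          by (simp add: F1_def D1_def g_def)
      qed
      have fd: "(\<lambda>w. F1 w / D1 w) field_differentiable at z"
        using F1 D1 \<open>D1 z \<noteq> 0\<close> by (intro field_differentiable_divide diff)
      show ?thesis
        by (rule field_differentiable_transform_within[OF e(1) UNIV_I eq fd])
    next
      case False
      then obtain e where e: "0 < e" "\<forall>w\<in>ball z e. D w \<noteq> 0" using nhd[OF D] by blast
      have eq: "F w / D w = g w" if "dist w z < e" for w
        using e(2) that by (simp add: g_def dist_commute)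
      have fd: "(\<lambda>w. F w / D w) field_differentiable at z"
        using F D False by (intro field_differentiable_divide diff)
      show ?thesis
        by (rule field_differentiable_transform_within[OF e(1) UNIV_I eq fd])
    qed
  qed
  then have "g holomorphic_on UNIV" by (simp add: holomorphic_on_def)
  moreover have "F z = g z * D z" for z using zeros[of z] by (simp add: g_def)
  ultimately show ?thesis using that by blast
qed

section \<open>The characteristic function\<close>

text \<open>\<open>Y\<close> solves the problem on the left interval from its left end, \<open>Z\<close> the one on the right
  interval from its right end (so \<open>q2\<close> is reflected); \<open>d\<close> is the length of the gap and \<open>c\<close> the
  value of the potential at its left end. \<open>left_val\<close> and \<open>left_der\<close> are the values of the left
  solution and its derivative after the jump.\<close>

locale jump_problem =
  fixes a d c h H :: real and q1 q2 :: "real \<Rightarrow> real"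
    and Y Y' Z Z' :: "complex \<Rightarrow> real \<Rightarrow> complex"
  assumes a_pos: "0 < a" and d_pos: "0 < d"
    and q1: "continuous_on {0..a} q1" and q2: "continuous_on {0..a} q2"
    and Y: "sl_family a q1 1 (of_real h) Y Y'" and Z: "sl_family a q2 1 (of_real H) Z Z'"
begin

definition left_val :: "complex \<Rightarrow> complex" where
  "left_val \<mu> = Y \<mu> a + of_real d * Y' \<mu> a"

definition left_der :: "complex \<Rightarrow> complex" where
  "left_der \<mu> = Y' \<mu> a + of_real d * (of_real c - \<mu>) * left_val \<mu>"

text \<open>Up to sign, the Wronskian after the gap of the left and right solutions; the plus sign
  arises because \<open>Z'\<close> is taken in the reflected direction.\<close>

definition char_fun :: "complex \<Rightarrow> complex" where
  "char_fun \<mu> = left_der \<mu> * Z \<mu> a + left_val \<mu> * Z' \<mu> a"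

lemma char_fun_holomorphic: "char_fun holomorphic_on UNIV"
proof -
  have a: "0 \<le> a" "a \<in> {0..a}" using a_pos by auto
  show ?thesis
    unfolding char_fun_def left_der_def left_val_def
    by (intro holomorphic_intros sl_family_holomorphic[OF a(1) q1 Y a(2)] sl_family_holomorphic[OF a(1) q2 Z a(2)])
qed

text \<open>After multiplication by the conjugates of \<open>left_val\<close> and \<open>Z\<close>,
  the imaginary parts from the left, the gap and the right all carry the sign of
  \<open>- Im \<mu>\<close> and cannot cancel. The arithmetic-geometric mean inequality then allows
  division by the moduli of the two factors. The linear rate in \<open>Im \<mu>\<close> excludes
  nonreal zeros and, at real ones, higher multiplicity.\<close>

lemma char_fun_lower_nonreal:
  obtains n0 where "0 < n0"
    "\<And>\<mu>. norm \<mu> \<le> M \<Longrightarrow> Im \<mu> \<noteq> 0 \<Longrightarrow> 2 * n0 * \<bar>Im \<mu>\<bar> \<le> norm (char_fun \<mu>)"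
proof -
  have a: "0 \<le> a" using a_pos by simp
  obtain n1 where n1: "0 < n1" "\<And>\<mu>. norm \<mu> \<le> M \<Longrightarrow> n1 \<le> integral {0..a} (\<lambda>x. (norm (Y \<mu> x))\<^sup>2)"
    using sl_family_integral_lower[OF a_pos q1 Y] by metis
  obtain n2 where n2: "0 < n2" "\<And>\<mu>. norm \<mu> \<le> M \<Longrightarrow> n2 \<le> integral {0..a} (\<lambda>x. (norm (Z \<mu> x))\<^sup>2)"
    using sl_family_integral_lower[OF a_pos q2 Z] by metis
  define n0 where "n0 = min n1 n2"
  have "2 * n0 * \<bar>Im \<mu>\<bar> \<le> norm (char_fun \<mu>)" if M: "norm \<mu> \<le> M" and im: "Im \<mu> \<noteq> 0" for \<mu>
  proof -
    define N1 where "N1 = integral {0..a} (\<lambda>x. (norm (Y \<mu> x))\<^sup>2)"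
    define N2 where "N2 = integral {0..a} (\<lambda>x. (norm (Z \<mu> x))\<^sup>2)"
    have N: "n0 \<le> N1" "n0 \<le> N2" "0 < n0"
      using n1 n2(1) n1(2)[OF M] n2(2)[OF M] by (auto simp: n0_def N1_def N2_def)
    let ?A = "left_val \<mu>" and ?B = "left_der \<mu>" and ?Z = "Z \<mu> a" and ?Z' = "Z' \<mu> a"
    have hY: "Im (Y' \<mu> a * cnj (Y \<mu> a)) = - Im \<mu> * N1"
      unfolding N1_def by (rule sl_family_herglotz[OF a Y])
    have hZ: "Im (?Z' * cnj ?Z) = - Im \<mu> * N2"
      unfolding N2_def by (rule sl_family_herglotz[OF a Z])
    \<comment> \<open>The jump preserves the Herglotz sign: the term with \<open>Y' * cnj Y'\<close>
      is real, and the one with \<open>- \<mu>\<close> adds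
      \<open>d * (norm (left_val \<mu>))\<^sup>2\<close> to the integral.\<close>
    have hA: "Im (?B * cnj ?A) = - Im \<mu> * (N1 + d * (norm ?A)\<^sup>2)"
    proof -
      have "?B * cnj ?A = Y' \<mu> a * cnj (Y \<mu> a) + of_real d * (Y' \<mu> a * cnj (Y' \<mu> a))
          + of_real d * (of_real c - \<mu>) * (?A * cnj ?A)"
        unfolding left_der_def by (simp add: left_val_def algebra_simps)
      also have "Im \<dots> = - Im \<mu> * N1 - d * Im \<mu> * (norm ?A)\<^sup>2"
        unfolding complex_norm_square [symmetric] plus_complex.sel hY by simp
      finally show ?thesis by (simp add: algebra_simps)
    qed
    have A0: "?A \<noteq> 0"
    proof
      assume "?A = 0"
      then show False using hA im N by simp
    qed
    have Z0: "?Z \<noteq> 0"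
    proof
      assume "?Z = 0"
      then show False using hZ im N by simp
    qed
    have "char_fun \<mu> * (cnj ?A * cnj ?Z) = (?B * cnj ?A) * (?Z * cnj ?Z) + (?A * cnj ?A) * (?Z' * cnj ?Z)"
      by (simp add: char_fun_def algebra_simps)
    also have "Im \<dots> = - Im \<mu> * ((N1 + d * (norm ?A)\<^sup>2) * (norm ?Z)\<^sup>2 + (norm ?A)\<^sup>2 * N2)"
    proof -
      have lin: "Im (p * of_real s + of_real t * p') = Im p * s + t * Im p'" for p p' :: complex and s t
        by simp
      show ?thesis
        unfolding complex_norm_square [symmetric] lin hA hZ by (simp add: algebra_simps)
    qed
    finally have "\<bar>Im \<mu>\<bar> * ((N1 + d * (norm ?A)\<^sup>2) * (norm ?Z)\<^sup>2 + (norm ?A)\<^sup>2 * N2)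
        \<le> norm (char_fun \<mu> * (cnj ?A * cnj ?Z))"
      using abs_Im_le_cmod[of "char_fun \<mu> * (cnj ?A * cnj ?Z)"] N d_pos
      by (simp add: abs_mult)
    moreover have "n0 * (2 * norm ?A * norm ?Z) \<le> (N1 + d * (norm ?A)\<^sup>2) * (norm ?Z)\<^sup>2 + (norm ?A)\<^sup>2 * N2"
    proof -
      have "n0 * (2 * norm ?A * norm ?Z) \<le> n0 * ((norm ?Z)\<^sup>2 + (norm ?A)\<^sup>2)"
        using N sum_squares_bound[of "norm ?Z" "norm ?A"] by (intro mult_left_mono) (auto simp: mult_ac)
      also have "\<dots> = n0 * (norm ?Z)\<^sup>2 + (norm ?A)\<^sup>2 * n0" by (simp add: algebra_simps)
      also have "\<dots> \<le> (N1 + d * (norm ?A)\<^sup>2) * (norm ?Z)\<^sup>2 + (norm ?A)\<^sup>2 * N2"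
        using N d_pos by (intro add_mono mult_right_mono mult_left_mono) (auto intro: add_increasing2)
      finally show ?thesis .
    qed
    ultimately have "\<bar>Im \<mu>\<bar> * (n0 * (2 * norm ?A * norm ?Z)) \<le> norm (char_fun \<mu> * (cnj ?A * cnj ?Z))"
      by (meson abs_ge_zero mult_left_mono order_trans)
    then have "(norm ?A * norm ?Z) * (2 * n0 * \<bar>Im \<mu>\<bar>) \<le> (norm ?A * norm ?Z) * norm (char_fun \<mu>)"
      by (simp add: norm_mult mult_ac)
    moreover have "0 < norm ?A * norm ?Z" using A0 Z0 by simp
    ultimately show ?thesis by (simp only: mult_le_cancel_left_pos)
  qed
  moreover have "0 < n0" using n1 n2 by (simp add: n0_def)
  ultimately show ?thesis using that by blast
qed

lemma char_fun_zero_real: "char_fun \<mu> = 0 \<Longrightarrow> Im \<mu> = 0"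
proof (rule ccontr)
  assume "char_fun \<mu> = 0" "Im \<mu> \<noteq> 0"
  moreover obtain n0 where "0 < n0"
    "\<And>\<nu>. norm \<nu> \<le> norm \<mu> \<Longrightarrow> Im \<nu> \<noteq> 0 \<Longrightarrow> 2 * n0 * \<bar>Im \<nu>\<bar> \<le> norm (char_fun \<nu>)"
    using char_fun_lower_nonreal by blast
  ultimately show False by (smt (verit) mult_pos_pos norm_zero zero_less_abs_iff)
qed

text \<open>A multiple zero would make \<^term>\<open>char_fun\<close> small of second order along the vertical line
  through it.\<close>

lemma char_fun_zero_simple:
  assumes "char_fun \<mu> = 0"
  shows "deriv char_fun \<mu> \<noteq> 0"
proof
  assume "deriv char_fun \<mu> = 0"
  have im: "Im \<mu> = 0" by (rule char_fun_zero_real[OF assms])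
  obtain n0 where n0: "0 < n0"
    "\<And>\<nu>. norm \<nu> \<le> norm \<mu> + 1 \<Longrightarrow> Im \<nu> \<noteq> 0 \<Longrightarrow> 2 * n0 * \<bar>Im \<nu>\<bar> \<le> norm (char_fun \<nu>)"
    using char_fun_lower_nonreal by blast
  have "(char_fun has_field_derivative 0) (at \<mu>)"
    using holomorphic_derivI[OF char_fun_holomorphic] \<open>deriv char_fun \<mu> = 0\<close> by (metis UNIV_I open_UNIV)
  then have lim: "((\<lambda>w. (char_fun (\<mu> + w) - char_fun \<mu>) / w) \<longlongrightarrow> 0) (at 0)"
    by (simp add: DERIV_def)
  have "filterlim (\<lambda>n. \<i> * complex_of_real (inverse (real (Suc n)))) (at 0) sequentially"
    unfolding filterlim_at
  proof
    have "(\<lambda>n. \<i> * complex_of_real (inverse (real (Suc n)))) \<longlonglongrightarrow> \<i> * of_real 0"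
      by (intro tendsto_intros LIMSEQ_inverse_real_of_nat)
    then show "(\<lambda>n. \<i> * complex_of_real (inverse (real (Suc n)))) \<longlonglongrightarrow> 0" by simp
  qed (auto simp del: of_nat_Suc)
  from tendsto_norm[OF filterlim_compose[OF lim this]]
  have "(\<lambda>n. norm ((char_fun (\<mu> + \<i> * complex_of_real (inverse (real (Suc n)))) - char_fun \<mu>)
      / (\<i> * complex_of_real (inverse (real (Suc n)))))) \<longlonglongrightarrow> 0"
    by simp
  then have "2 * n0 \<le> 0"
  proof (rule tendsto_lowerbound)
    have slope: "2 * n0 \<le> norm ((char_fun (\<mu> + \<i> * of_real s) - char_fun \<mu>) / (\<i> * of_real s))"
      if s: "0 < s" "s \<le> 1" for s :: real
    proof -
      have "norm (\<mu> + \<i> * of_real s) \<le> norm \<mu> + 1"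
        using norm_triangle_ineq[of \<mu> "\<i> * of_real s"] s by (simp add: norm_mult)
      then have "2 * n0 * s \<le> norm (char_fun (\<mu> + \<i> * of_real s))"
        using n0(2)[of "\<mu> + \<i> * of_real s"] im s by simp
      then show ?thesis using s assms by (simp add: norm_divide norm_mult pos_le_divide_eq)
    qed
    show "\<forall>\<^sub>F n in sequentially. 2 * n0 \<le> norm ((char_fun (\<mu> + \<i> * complex_of_real (inverse (real (Suc n)))) - char_fun \<mu>)
      / (\<i> * complex_of_real (inverse (real (Suc n)))))"
      by (intro always_eventually allI slope) (auto simp: inverse_le_1_iff)
  qed simp
  then show False using n0(1) by simp
qed

end

section \<open>Growth at the endpoint and division by the characteristic function\<close>

lemma sl_family_crude_bounds:
  assumes "0 < a" "continuous_on {0..a} q" "sl_family a q 1 \<beta> Y Y'"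
  obtains K R where "1 \<le> K" "1 \<le> R"
    "\<And>\<rho>. R \<le> norm \<rho> \<Longrightarrow> norm (Y (\<rho>\<^sup>2) a) \<le> K * exp (\<bar>Im \<rho>\<bar> * a)"
    "\<And>\<rho>. R \<le> norm \<rho> \<Longrightarrow> norm (Y' (\<rho>\<^sup>2) a) \<le> K * norm \<rho> * exp (\<bar>Im \<rho>\<bar> * a)"
    "\<And>\<rho>. R \<le> norm \<rho> \<Longrightarrow> norm (Y (\<rho>\<^sup>2) a - cos (\<rho> * a)) \<le> K * exp (\<bar>Im \<rho>\<bar> * a) / norm \<rho>"
    "\<And>\<rho>. R \<le> norm \<rho> \<Longrightarrow> norm (Y' (\<rho>\<^sup>2) a + \<rho> * sin (\<rho> * a)) \<le> K * exp (\<bar>Im \<rho>\<bar> * a)"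
proof -
  have a: "0 \<le> a" "a \<in> {0..a}" using \<open>0 < a\<close> by auto
  obtain K R where KR: "0 \<le> K" "1 \<le> R"
    and cos: "\<And>\<rho> x. R \<le> norm \<rho> \<Longrightarrow> x \<in> {0..a} \<Longrightarrow>
       norm (Y (\<rho>\<^sup>2) x - 1 * cos (\<rho> * x)) \<le> K * exp (\<bar>Im \<rho>\<bar> * x) / norm \<rho>"
    and sin: "\<And>\<rho> x. R \<le> norm \<rho> \<Longrightarrow> x \<in> {0..a} \<Longrightarrow>
       norm (Y' (\<rho>\<^sup>2) x + 1 * \<rho> * sin (\<rho> * x)) \<le> K * exp (\<bar>Im \<rho>\<bar> * x)"
    using sl_family_asymptotics[OF a(1) assms(2,3)] by metis
  show ?thesis
  proof
    show "1 \<le> 1 + K" "1 \<le> R" using KR by auto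
    fix \<rho> :: complex assume r: "R \<le> norm \<rho>"
    let ?e = "exp (\<bar>Im \<rho>\<bar> * a)"
    have r1: "1 \<le> norm \<rho>" using r KR(2) by linarith
    have c: "norm (Y (\<rho>\<^sup>2) a - cos (\<rho> * a)) \<le> K * ?e / norm \<rho>" using cos[OF r a(2)] by simp
    have s: "norm (Y' (\<rho>\<^sup>2) a + \<rho> * sin (\<rho> * a)) \<le> K * ?e" using sin[OF r a(2)] by simp
    have trig: "norm (complex_of_real a) = a" "norm (cos (\<rho> * a)) \<le> ?e" "norm (sin (\<rho> * a)) \<le> ?e"
      using norm_cos_le_exp[of "\<rho> * a"] norm_sin_le_exp[of "\<rho> * a"] a by (auto simp: abs_mult)
    have div: "K * ?e / norm \<rho> \<le> K * ?e"
      using mult_left_mono[OF r1, of "K * ?e"] r1 KR(1) by (auto simp: divide_le_eq)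
    show "norm (Y (\<rho>\<^sup>2) a - cos (\<rho> * a)) \<le> (1 + K) * ?e / norm \<rho>"
      by (rule order_trans[OF c]) (auto intro!: divide_right_mono mult_right_mono)
    show "norm (Y' (\<rho>\<^sup>2) a + \<rho> * sin (\<rho> * a)) \<le> (1 + K) * ?e"
      by (rule order_trans[OF s]) (auto intro!: mult_right_mono)
    have "norm (Y (\<rho>\<^sup>2) a) \<le> norm (Y (\<rho>\<^sup>2) a - cos (\<rho> * a)) + norm (cos (\<rho> * a))" by norm
    then show "norm (Y (\<rho>\<^sup>2) a) \<le> (1 + K) * ?e"
      using c div trig(2) by (simp add: algebra_simps)
    have "norm (Y' (\<rho>\<^sup>2) a) \<le> norm (Y' (\<rho>\<^sup>2) a + \<rho> * sin (\<rho> * a)) + norm (\<rho> * sin (\<rho> * a))" by norm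
    also have "\<dots> \<le> K * norm \<rho> * ?e + norm \<rho> * ?e"
    proof (rule add_mono)
      show "norm (Y' (\<rho>\<^sup>2) a + \<rho> * sin (\<rho> * a)) \<le> K * norm \<rho> * ?e"
        by (rule order_trans[OF s]) (use r1 KR(1) in \<open>auto simp: mult_le_cancel_left1 intro!: mult_right_mono\<close>)
      show "norm (\<rho> * sin (\<rho> * a)) \<le> norm \<rho> * ?e"
        unfolding norm_mult using trig(3) by (intro mult_left_mono) auto
    qed
    finally show "norm (Y' (\<rho>\<^sup>2) a) \<le> (1 + K) * norm \<rho> * ?e" by (simp add: algebra_simps)
  qed
qed

context jump_problem
begin

text \<open>The leading term of \<^term>\<open>char_fun (\<rho>\<^sup>2)\<close> is
  \<open>- d\<^sup>2 * \<rho>\<^sup>2 * Y' * Z \<approx> d\<^sup>2 * \<rho>\<^sup>3 * sin (\<rho> * a) * cos (\<rho> * a)\<close>.\<close>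

lemma char_fun_lower_on_square:
  obtains R where "1 \<le> R" "\<And>n \<rho>. on_square (square_radius a n) \<rho> \<Longrightarrow> R \<le> norm \<rho> \<Longrightarrow>
    (norm \<rho> * exp (\<bar>Im \<rho>\<bar> * a))\<^sup>2 \<le> norm (char_fun (\<rho>\<^sup>2))"
proof -
  obtain K1 R1 where KR1: "1 \<le> K1" "1 \<le> R1"
    and y: "\<And>\<rho>. R1 \<le> norm \<rho> \<Longrightarrow> norm (Y (\<rho>\<^sup>2) a) \<le> K1 * exp (\<bar>Im \<rho>\<bar> * a)"
    and y': "\<And>\<rho>. R1 \<le> norm \<rho> \<Longrightarrow> norm (Y' (\<rho>\<^sup>2) a) \<le> K1 * norm \<rho> * exp (\<bar>Im \<rho>\<bar> * a)"
    and ys: "\<And>\<rho>. R1 \<le> norm \<rho> \<Longrightarrow> norm (Y' (\<rho>\<^sup>2) a + \<rho> * sin (\<rho> * a)) \<le> K1 * exp (\<bar>Im \<rho>\<bar> * a)"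
    using sl_family_crude_bounds[OF a_pos q1 Y] by metis
  obtain K2 R2 where KR2: "1 \<le> K2" "1 \<le> R2"
    and z: "\<And>\<rho>. R2 \<le> norm \<rho> \<Longrightarrow> norm (Z (\<rho>\<^sup>2) a) \<le> K2 * exp (\<bar>Im \<rho>\<bar> * a)"
    and z': "\<And>\<rho>. R2 \<le> norm \<rho> \<Longrightarrow> norm (Z' (\<rho>\<^sup>2) a) \<le> K2 * norm \<rho> * exp (\<bar>Im \<rho>\<bar> * a)"
    and zc: "\<And>\<rho>. R2 \<le> norm \<rho> \<Longrightarrow> norm (Z (\<rho>\<^sup>2) a - cos (\<rho> * a)) \<le> K2 * exp (\<bar>Im \<rho>\<bar> * a) / norm \<rho>"
    using sl_family_crude_bounds[OF a_pos q2 Z] by metis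
  \<comment> \<open>\<open>L\<close> collects the terms of order at most two in
    \<open>norm \<rho>\<close>, \<open>P\<close> the error in the leading cubic term, and
    \<open>R\<close> forces \<open>d\<^sup>2 * norm \<rho> / 8 - P \<ge> 1 + L\<close>. One power of
    \<open>norm \<rho>\<close> is thus spent on the errors, which leaves the quadratic lower
    bound.\<close>
  define L where "L = K1 * K2 * (1 + d * \<bar>c\<bar> * (1 + d) + d + (1 + d))"
  define P where "P = d\<^sup>2 * (K1 * K2 + K2)"
  define R where "R = max (max R1 R2) (8 * (1 + L + P) / d\<^sup>2)"
  show ?thesis
  proof
    show "1 \<le> R" using KR1 by (simp add: R_def)
    fix n \<rho> assume sq: "on_square (square_radius a n) \<rho>" and "R \<le> norm \<rho>"
    then have r: "R1 \<le> norm \<rho>" "R2 \<le> norm \<rho>" "8 * (1 + L + P) / d\<^sup>2 \<le> norm \<rho>"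
      by (auto simp: R_def)
    define r e where "r = norm \<rho>" and "e = exp (\<bar>Im \<rho>\<bar> * a)"
    define u u' w w' where "u = Y (\<rho>\<^sup>2) a" and "u' = Y' (\<rho>\<^sup>2) a" and "w = Z (\<rho>\<^sup>2) a" and "w' = Z' (\<rho>\<^sup>2) a"
    define \<delta> \<gamma> where "\<delta> = complex_of_real d" and "\<gamma> = complex_of_real c"
    have nd: "norm \<delta> = d" "norm \<gamma> = \<bar>c\<bar>" using d_pos by (auto simp: \<delta>_def \<gamma>_def)
    have e0: "0 < e" by (simp add: e_def)
    have r1: "1 \<le> r" using r(1) KR1(2) by (simp add: r_def)
    have b: "norm u \<le> K1 * e" "norm u' \<le> K1 * r * e" "norm (u' + \<rho> * sin (\<rho> * a)) \<le> K1 * e"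
      "norm w \<le> K2 * e" "norm w' \<le> K2 * r * e" "norm (w - cos (\<rho> * a)) \<le> K2 * e / r"
      unfolding u_def u'_def w_def w'_def r_def e_def
      using y[OF r(1)] y'[OF r(1)] ys[OF r(1)] z[OF r(2)] z'[OF r(2)] zc[OF r(2)] by auto
    have b': "norm u \<le> K1 * r * e" "norm (u + \<delta> * u') \<le> (1 + d) * (K1 * r * e)"
    proof -
      have "K1 * e \<le> K1 * r * e" using r1 KR1 e0 by simp
      with b(1) show *: "norm u \<le> K1 * r * e" by linarith
      have "norm (u + \<delta> * u') \<le> norm u + d * norm u'"
        using norm_triangle_ineq[of u "\<delta> * u'"] by (simp add: norm_mult nd)
      also have "\<dots> \<le> K1 * r * e + d * (K1 * r * e)"
        using * b(2) d_pos by (intro add_mono mult_left_mono) auto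
      finally show "norm (u + \<delta> * u') \<le> (1 + d) * (K1 * r * e)" by (simp add: algebra_simps)
    qed
    have nonneg: "0 \<le> K1 * e" "0 \<le> K1 * r * e" "0 \<le> K2 * e" "0 \<le> K2 * r * e"
      using KR1 KR2 r1 e0 by auto
    have rr: "r \<le> r\<^sup>2" using r1 by (simp add: power2_eq_square)
    define rest where "rest = u' * w + \<delta> * \<gamma> * (u + \<delta> * u') * w - \<delta> * \<rho>\<^sup>2 * u * w + (u + \<delta> * u') * w'"
    have char: "char_fun (\<rho>\<^sup>2) = rest - \<delta>\<^sup>2 * \<rho>\<^sup>2 * (u' * w)"
      unfolding char_fun_def left_der_def left_val_def rest_def u_def u'_def w_def w'_def \<delta>_def \<gamma>_def
      by (simp add: algebra_simps power2_eq_square)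
    have "norm rest \<le> norm (u' * w) + norm (\<delta> * \<gamma> * (u + \<delta> * u') * w) + norm (\<delta> * \<rho>\<^sup>2 * u * w)
        + norm ((u + \<delta> * u') * w')"
      unfolding rest_def by norm
    also have "\<dots> \<le> (K1 * r * e) * (K2 * e) + d * \<bar>c\<bar> * ((1 + d) * (K1 * r * e)) * (K2 * e)
        + d * r\<^sup>2 * (K1 * e) * (K2 * e) + ((1 + d) * (K1 * r * e)) * (K2 * r * e)"
      unfolding norm_mult norm_power nd r_def [symmetric]
      using b b' nonneg d_pos r1 e0 KR1 KR2
      by (intro add_mono mult_mono mult_nonneg_nonneg) auto
    also have "\<dots> = K1 * K2 * e\<^sup>2 * (r * (1 + d * \<bar>c\<bar> * (1 + d)) + r\<^sup>2 * (d + (1 + d)))"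
      by (simp add: algebra_simps power2_eq_square)
    also have "\<dots> \<le> K1 * K2 * e\<^sup>2 * (r\<^sup>2 * (1 + d * \<bar>c\<bar> * (1 + d)) + r\<^sup>2 * (d + (1 + d)))"
      using rr KR1 KR2 d_pos by (intro mult_left_mono add_right_mono mult_right_mono) auto
    also have "\<dots> = L * (r * e)\<^sup>2"
      by (simp add: L_def algebra_simps power_mult_distrib)
    finally have rest: "norm rest \<le> L * (r * e)\<^sup>2" .
    have err: "norm (u' * w + \<rho> * sin (\<rho> * a) * cos (\<rho> * a)) \<le> (K1 * K2 + K2) * e\<^sup>2"
    proof -
      have "u' * w + \<rho> * sin (\<rho> * a) * cos (\<rho> * a)
          = (u' + \<rho> * sin (\<rho> * a)) * w - \<rho> * sin (\<rho> * a) * (w - cos (\<rho> * a))"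
        by (simp add: algebra_simps)
      also have "norm \<dots> \<le> norm (u' + \<rho> * sin (\<rho> * a)) * norm w
          + r * norm (sin (\<rho> * a)) * norm (w - cos (\<rho> * a))"
        by (rule order_trans[OF norm_triangle_ineq4]) (simp add: norm_mult r_def)
      also have "\<dots> \<le> (K1 * e) * (K2 * e) + r * e * (K2 * e / r)"
      proof -
        have "norm (sin (\<rho> * a)) \<le> e"
          using norm_sin_le_exp[of "\<rho> * a"] a_pos by (simp add: e_def abs_mult)
        then show ?thesis
          using b nonneg r1 e0 KR1 KR2 by (intro add_mono mult_mono mult_nonneg_nonneg) auto
      qed
      also have "\<dots> = (K1 * K2 + K2) * e\<^sup>2" using r1 by (simp add: field_simps power2_eq_square)
      finally show ?thesis .
    qed
    \<comment> \<open>Sine and cosine are bounded below together, as half of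
      \<open>sin (2 * a * \<rho>)\<close>, the function to which the squares are adapted.\<close>
    have main: "r * e\<^sup>2 / 8 \<le> norm (\<rho> * sin (\<rho> * a) * cos (\<rho> * a))"
    proof -
      have "e\<^sup>2 = exp (2 * a * \<bar>Im \<rho>\<bar>)" unfolding e_def by (simp add: exp_double [symmetric] mult_ac)
      then have "e\<^sup>2 / 4 \<le> norm (sin (2 * (\<rho> * a)))"
        using norm_sin_on_square[OF a_pos sq] by (simp add: mult_ac)
      then have "e\<^sup>2 / 8 \<le> norm (sin (\<rho> * a)) * norm (cos (\<rho> * a))"
        by (simp add: sin_double norm_mult)
      then have "r * (e\<^sup>2 / 8) \<le> r * (norm (sin (\<rho> * a)) * norm (cos (\<rho> * a)))"
        using r1 by (intro mult_left_mono) auto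
      then show ?thesis by (simp add: norm_mult r_def mult_ac)
    qed
    have "r * e\<^sup>2 / 8 - (K1 * K2 + K2) * e\<^sup>2 \<le> norm (u' * w)"
      using main err norm_triangle_ineq2[of "\<rho> * sin (\<rho> * a) * cos (\<rho> * a)" "- (u' * w)"]
      by (simp add: add.commute)
    then have "d\<^sup>2 * r\<^sup>2 * (r * e\<^sup>2 / 8 - (K1 * K2 + K2) * e\<^sup>2) \<le> norm (\<delta>\<^sup>2 * \<rho>\<^sup>2 * (u' * w))"
      unfolding norm_mult[of "\<delta>\<^sup>2 * \<rho>\<^sup>2"] norm_mult[of "\<delta>\<^sup>2"] norm_power nd r_def [symmetric]
      by (intro mult_left_mono) auto
    moreover have "d\<^sup>2 * r\<^sup>2 * (r * e\<^sup>2 / 8 - (K1 * K2 + K2) * e\<^sup>2) = (d\<^sup>2 * r / 8 - P) * (r * e)\<^sup>2"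
      by (simp add: P_def algebra_simps power_mult_distrib)
    moreover have "norm (\<delta>\<^sup>2 * \<rho>\<^sup>2 * (u' * w)) - norm rest \<le> norm (char_fun (\<rho>\<^sup>2))"
      unfolding char by norm
    moreover have "(1 + L) * (r * e)\<^sup>2 \<le> (d\<^sup>2 * r / 8 - P) * (r * e)\<^sup>2"
      using r(3) d_pos by (intro mult_right_mono) (auto simp: r_def field_simps)
    ultimately have "(r * e)\<^sup>2 \<le> norm (char_fun (\<rho>\<^sup>2))"
      using rest by (simp add: distrib_right)
    then show "(norm \<rho> * exp (\<bar>Im \<rho>\<bar> * a))\<^sup>2 \<le> norm (char_fun (\<rho>\<^sup>2))" by (simp add: r_def e_def)
  qed
qed

text \<open>The zeros of \<^term>\<open>char_fun\<close> are real and simple, so \<open>F / char_fun\<close> is entire, and it is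
  small on large squares.\<close>

lemma vanishes_if_zero_on_spectrum:
  assumes F: "F holomorphic_on UNIV"
    and growth: "\<And>\<rho>. R \<le> norm \<rho> \<Longrightarrow> norm (F (\<rho>\<^sup>2)) \<le> C * norm \<rho> * (exp (\<bar>Im \<rho>\<bar> * a))\<^sup>2"
    and zero: "\<And>t. char_fun (complex_of_real t) = 0 \<Longrightarrow> F (of_real t) = 0"
  shows "F \<mu> = 0"
proof -
  obtain g where g: "g holomorphic_on UNIV" "\<And>z. F z = g z * char_fun z"
  proof (rule entire_quotient[OF F char_fun_holomorphic])
    fix z assume z: "char_fun z = 0"
    then have "z = of_real (Re z)" using char_fun_zero_real by (simp add: complex_eq_iff)
    then have "F z = 0" using z zero by metis
    then show "F z = 0 \<and> deriv char_fun z \<noteq> 0" using char_fun_zero_simple[OF z] by simp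
  qed blast
  obtain R' where R': "1 \<le> R'" "\<And>n \<rho>. on_square (square_radius a n) \<rho> \<Longrightarrow> R' \<le> norm \<rho> \<Longrightarrow>
    (norm \<rho> * exp (\<bar>Im \<rho>\<bar> * a))\<^sup>2 \<le> norm (char_fun (\<rho>\<^sup>2))"
    using char_fun_lower_on_square by blast
  have "g ((csqrt \<mu>)\<^sup>2) = 0"
  proof (rule entire_vanishes_by_squares[OF entire_compose_square[OF g(1)] a_pos])
    fix n \<rho> assume sq: "on_square (square_radius a n) \<rho>" and r: "max R R' \<le> norm \<rho>"
    let ?s = "(norm \<rho> * exp (\<bar>Im \<rho>\<bar> * a))\<^sup>2"
    have r0: "0 < norm \<rho>" using r R'(1) by linarith
    then have s0: "0 < ?s" by simp
    have "?s * norm (g (\<rho>\<^sup>2)) \<le> norm (char_fun (\<rho>\<^sup>2)) * norm (g (\<rho>\<^sup>2))"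
      using r by (intro mult_right_mono R'(2)[OF sq]) auto
    also have "\<dots> = norm (F (\<rho>\<^sup>2))" by (simp add: g(2) norm_mult)
    also have "\<dots> \<le> C * norm \<rho> * (exp (\<bar>Im \<rho>\<bar> * a))\<^sup>2" using r by (intro growth) auto
    also have "\<dots> = ?s * (C / norm \<rho>)" using r0 by (simp add: field_simps power2_eq_square)
    finally show "norm (g (\<rho>\<^sup>2)) \<le> C / norm \<rho>" using s0 by (simp only: mult_le_cancel_left_pos)
  qed
  then show ?thesis by (simp add: g(2))
qed

text \<open>The potentials compared here are independent of those in the locale, whose
  \<open>char_fun\<close> serves only as divisor. The lemma therefore applies to the left and to the
  reflected right interval alike.\<close>

lemma potential_unique_if_equal_on_spectrum:
  assumes q: "continuous_on {0..a} q" and qt: "continuous_on {0..a} qt"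
    and V: "sl_family a q 1 \<beta> V V'" and W: "sl_family a qt 1 \<gamma> W W'"
    and spec: "\<And>t. char_fun (complex_of_real t) = 0 \<Longrightarrow>
      V' (of_real t) a * W (of_real t) a = W' (of_real t) a * V (of_real t) a"
    and x: "x \<in> {0..a}"
  shows "q x = qt x"
proof (rule borg_uniqueness[OF a_pos q qt V W _ x])
  fix \<mu>
  have a: "0 \<le> a" "a \<in> {0..a}" using a_pos by auto
  obtain K1 R1 where 1: "1 \<le> K1" "1 \<le> R1"
    "\<And>\<rho>. R1 \<le> norm \<rho> \<Longrightarrow> norm (V (\<rho>\<^sup>2) a) \<le> K1 * exp (\<bar>Im \<rho>\<bar> * a)"
    "\<And>\<rho>. R1 \<le> norm \<rho> \<Longrightarrow> norm (V' (\<rho>\<^sup>2) a) \<le> K1 * norm \<rho> * exp (\<bar>Im \<rho>\<bar> * a)"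
    using sl_family_crude_bounds[OF a_pos q V] by metis
  obtain K2 R2 where 2: "1 \<le> K2" "1 \<le> R2"
    "\<And>\<rho>. R2 \<le> norm \<rho> \<Longrightarrow> norm (W (\<rho>\<^sup>2) a) \<le> K2 * exp (\<bar>Im \<rho>\<bar> * a)"
    "\<And>\<rho>. R2 \<le> norm \<rho> \<Longrightarrow> norm (W' (\<rho>\<^sup>2) a) \<le> K2 * norm \<rho> * exp (\<bar>Im \<rho>\<bar> * a)"
    using sl_family_crude_bounds[OF a_pos qt W] by metis
  define F where "F \<nu> = V' \<nu> a * W \<nu> a - W' \<nu> a * V \<nu> a" for \<nu>
  have "F \<mu> = 0"
  proof (rule vanishes_if_zero_on_spectrum[where F = F and R = "max R1 R2" and C = "2 * K1 * K2"])
    show "F holomorphic_on UNIV"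
      unfolding F_def
      by (intro holomorphic_intros sl_family_holomorphic[OF a(1) q V a(2)] sl_family_holomorphic[OF a(1) qt W a(2)])
  next
    fix t :: real assume "char_fun (of_real t) = 0"
    then show "F (of_real t) = 0" using spec by (simp add: F_def)
  next
    fix \<rho> :: complex assume r: "max R1 R2 \<le> norm \<rho>"
    let ?e = "exp (\<bar>Im \<rho>\<bar> * a)"
    have "norm (F (\<rho>\<^sup>2)) \<le> norm (V' (\<rho>\<^sup>2) a) * norm (W (\<rho>\<^sup>2) a) + norm (W' (\<rho>\<^sup>2) a) * norm (V (\<rho>\<^sup>2) a)"
      unfolding F_def by (rule order_trans[OF norm_triangle_ineq4]) (simp add: norm_mult)
    also have "\<dots> \<le> (K1 * norm \<rho> * ?e) * (K2 * ?e) + (K2 * norm \<rho> * ?e) * (K1 * ?e)"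
      using 1 2 r by (intro add_mono mult_mono) auto
    also have "\<dots> = 2 * K1 * K2 * norm \<rho> * ?e\<^sup>2" by (simp add: power2_eq_square)
    finally show "norm (F (\<rho>\<^sup>2)) \<le> 2 * K1 * K2 * norm \<rho> * ?e\<^sup>2" .
  qed
  then show "V' \<mu> a * W \<mu> a = W' \<mu> a * V \<mu> a" by (simp add: F_def)
qed

end

section \<open>The time scale with one gap\<close>

lemma tsigma_right_dense:
  assumes "t < b" "{t..b} \<subseteq> T"
  shows "tsigma T t = t"
proof -
  have b: "b \<in> T" "t < b" using assms by auto
  have "Inf {s \<in> T. t < s} = t"
  proof (rule cInf_eq_non_empty)
    show "{s \<in> T. t < s} \<noteq> {}" using b by auto
    show "t \<le> s" if "s \<in> {s \<in> T. t < s}" for s using that by auto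
    fix y assume y: "\<And>s. s \<in> {s \<in> T. t < s} \<Longrightarrow> y \<le> s"
    show "y \<le> t"
    proof (rule dense_ge_bounded[OF \<open>t < b\<close>])
      fix s assume "t < s" "s < b"
      then show "y \<le> s" using assms by (intro y) auto
    qed
  qed
  then show ?thesis using b by (auto simp: tsigma_def)
qed

lemma trho_left_dense:
  assumes "b < t" "{b..t} \<subseteq> T"
  shows "trho T t = t"
proof -
  have b: "b \<in> T" "b < t" using assms by auto
  have "Sup {s \<in> T. s < t} = t"
  proof (rule cSup_eq_non_empty)
    show "{s \<in> T. s < t} \<noteq> {}" using b by auto
    show "s \<le> t" if "s \<in> {s \<in> T. s < t}" for s using that by auto
    fix y assume y: "\<And>s. s \<in> {s \<in> T. s < t} \<Longrightarrow> s \<le> y"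
    show "t \<le> y"
    proof (rule dense_le_bounded[OF \<open>b < t\<close>])
      fix s assume "b < s" "s < t"
      then show "s \<le> y" using assms by (intro y) auto
    qed
  qed
  then show ?thesis using b by (auto simp: trho_def)
qed

lemma has_delta_derivative_right_dense:
  assumes "has_delta_derivative T f D t" "tsigma T t = t" "I \<subseteq> T"
  shows "(f has_real_derivative D) (at t within I)"
  unfolding has_field_derivative_def has_derivative_within_alt
proof (intro conjI allI impI)
  show "bounded_linear ((*) D)" by (rule bounded_linear_mult_right)
  fix e :: real assume "0 < e"
  then obtain d where d: "0 < d"
    "\<And>s. s \<in> T \<Longrightarrow> \<bar>s - t\<bar> < d \<Longrightarrow> \<bar>f t - f s - D * (t - s)\<bar> \<le> e * \<bar>t - s\<bar>"
    using assms(1,2) unfolding has_delta_derivative_def by metis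
  have "norm (f s - f t - D * (s - t)) \<le> e * norm (s - t)" if "s \<in> I" "norm (s - t) < d" for s
  proof -
    have "f s - f t - D * (s - t) = - (f t - f s - D * (t - s))" by (simp add: algebra_simps)
    then show ?thesis using d(2)[of s] that assms(3) by (auto simp: abs_minus_commute)
  qed
  then show "\<exists>d>0. \<forall>s\<in>I. norm (s - t) < d \<longrightarrow> norm (f s - f t - D * (s - t)) \<le> e * norm (s - t)"
    using d(1) by blast
qed

text \<open>Taking \<open>s = t\<close> in the definition forces the exact difference quotient
  across the gap. The inequality for nearby \<open>s\<close> then yields continuity at
  \<open>t\<close>, but no left derivative.\<close>

lemma has_delta_derivative_scattered:
  assumes "has_delta_derivative T f D t" "t \<in> T" "t < tsigma T t"
  shows "f (tsigma T t) = f t + (tsigma T t - t) * D" "continuous (at t within T) f"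
proof -
  let ?s = "tsigma T t"
  have D: "\<exists>d>0. \<forall>s\<in>T. \<bar>s - t\<bar> < d \<longrightarrow> \<bar>f ?s - f s - D * (?s - s)\<bar> \<le> e * \<bar>?s - s\<bar>" if "0 < e" for e
    using assms(1) that unfolding has_delta_derivative_def by blast
  have "\<bar>f ?s - f t - D * (?s - t)\<bar> \<le> 0"
  proof (rule field_le_epsilon)
    fix e :: real assume "0 < e"
    then have "0 < e / \<bar>?s - t\<bar>" using assms(3) by simp
    from D[OF this] have "\<bar>f ?s - f t - D * (?s - t)\<bar> \<le> e / \<bar>?s - t\<bar> * \<bar>?s - t\<bar>"
      using assms(2) by auto
    then show "\<bar>f ?s - f t - D * (?s - t)\<bar> \<le> 0 + e" using assms(3) by simp
  qed
  then show jump: "f ?s = f t + (?s - t) * D" by (simp add: algebra_simps)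
  show "continuous (at t within T) f"
    unfolding continuous_within_eps_delta dist_real_def
  proof (intro allI impI)
    fix e :: real assume e: "0 < e"
    define k where "k = 1 + \<bar>?s - t\<bar>"
    have k: "0 < k" by (simp add: k_def)
    have "0 < e / (2 * k)" using e k by simp
    from D[OF this] obtain d where d: "0 < d"
      "\<And>s. s \<in> T \<Longrightarrow> \<bar>s - t\<bar> < d \<Longrightarrow> \<bar>f ?s - f s - D * (?s - s)\<bar> \<le> e / (2 * k) * \<bar>?s - s\<bar>" by blast
    define d' where "d' = min (min d 1) (e / (4 * (1 + \<bar>D\<bar>)))"
    have d': "0 < d'" "d' \<le> d" "d' \<le> 1" "\<bar>D\<bar> * d' \<le> e / 4"
    proof -
      show "0 < d'" "d' \<le> d" "d' \<le> 1" using d(1) e by (auto simp: d'_def)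
      then have "\<bar>D\<bar> * d' \<le> (1 + \<bar>D\<bar>) * (e / (4 * (1 + \<bar>D\<bar>)))"
        by (intro mult_mono) (auto simp: d'_def)
      also have "\<dots> = e / 4" by (simp add: divide_simps)
      finally show "\<bar>D\<bar> * d' \<le> e / 4" .
    qed
    have "\<bar>f s - f t\<bar> < e" if "s \<in> T" "\<bar>s - t\<bar> < d'" for s
    proof -
      have "\<bar>f ?s - f s - D * (?s - s)\<bar> \<le> e / (2 * k) * \<bar>?s - s\<bar>"
        using that d' by (intro d(2)) auto
      also have "\<dots> \<le> e / (2 * k) * k"
        using that d' e k by (intro mult_left_mono) (auto simp: k_def)
      also have "\<dots> = e / 2" using k by simp
      finally have "\<bar>f t - f s - D * (t - s)\<bar> \<le> e / 2" unfolding jump by (simp add: algebra_simps)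
      moreover have "\<bar>D * (t - s)\<bar> \<le> \<bar>D\<bar> * d'"
        unfolding abs_mult using that by (intro mult_left_mono) auto
      ultimately show ?thesis using d'(4) e by linarith
    qed
    then show "\<exists>d>0. \<forall>s\<in>T. \<bar>s - t\<bar> < d \<longrightarrow> \<bar>f s - f t\<bar> < e" using d'(1) by blast
  qed
qed

lemma has_vector_derivative_complex_of_real:
  "(f has_vector_derivative D) F \<Longrightarrow> ((\<lambda>x. complex_of_real (f x)) has_vector_derivative of_real D) F"
  by (rule has_vector_derivative_of_real) (simp add: has_real_derivative_iff_has_vector_derivative)

text \<open>At the scattered point \<open>a1\<close> the delta derivative is the slope across the
  gap, so the left derivative has to be recovered from continuity of \<open>f\<close> and
  \<open>f'\<close> through the fundamental theorem of calculus.\<close>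

lemma has_vector_derivative_at_right_end:
  fixes f f' :: "real \<Rightarrow> real"
  assumes "0 < a" and f: "continuous_on {0..a} f" and f': "continuous_on {0..a} f'"
    and deriv: "\<And>t. t \<in> {0..<a} \<Longrightarrow> (f has_vector_derivative f' t) (at t within {0..a})"
    and x: "x \<in> {0..a}"
  shows "(f has_vector_derivative f' x) (at x within {0..a})"
proof -
  have eq: "f t = f 0 + integral {0..t} f'" if t: "t \<in> {0..a}" for t
  proof -
    have "(f' has_integral f t - f 0) {0..t}"
    proof (rule fundamental_theorem_of_calculus_interior)
      show "continuous_on {0..t} f" using t by (intro continuous_on_subset[OF f]) auto
      fix s assume s: "s \<in> {0<..<t}"
      then have "at s within {0..a} = at s" using t by (intro at_within_interior) auto
      then show "(f has_vector_derivative f' s) (at s)" using deriv[of s] s t by auto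
    qed (use t in auto)
    from integral_unique[OF this] show ?thesis by simp
  qed
  have "((\<lambda>t. f 0 + integral {0..t} f') has_vector_derivative 0 + f' x) (at x within {0..a})"
    by (intro derivative_intros integral_has_vector_derivative f' x)
  then show ?thesis
    using has_vector_derivative_transform[OF x eq] by simp
qed

locale two_intervals =
  fixes a1 a2 l :: real
  assumes a1: "0 < a1" and a12: "a1 < a2" and a2: "a2 < l"
begin

abbreviation "T \<equiv> {0..a1} \<union> {a2..l}"

lemma tsigma_T:
  "t \<in> {0..<a1} \<Longrightarrow> tsigma T t = t" "tsigma T a1 = a2" "t \<in> {a2..l} \<Longrightarrow> tsigma T t = t"
proof -
  show "tsigma T t = t" if "t \<in> {0..<a1}"
    by (rule tsigma_right_dense[of _ a1]) (use that in auto)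
  have "{s \<in> T. a1 < s} = {a2..l}" using a12 by auto
  then show "tsigma T a1 = a2" using a12 a2 by (auto simp: tsigma_def)
  \<comment> \<open>At \<open>l\<close> no later point exists and the default value of
    \<open>tsigma\<close> applies, so \<open>l\<close> behaves like a right-dense point.\<close>
  show "tsigma T t = t" if t: "t \<in> {a2..l}"
  proof (cases "t = l")
    case True
    then show ?thesis using a12 a2 by (auto simp: tsigma_def)
  next
    case False
    then show ?thesis by (intro tsigma_right_dense[of _ l]) (use t in auto)
  qed
qed

text \<open>The maximum \<open>l\<close> is left-dense, so nothing is removed; hence the second
  application of \<open>tkappa\<close> is trivial too.\<close>

lemma tkappa_T: "tkappa T = T"
proof -
  have "trho T l = l" by (rule trho_left_dense[of a2]) (use a2 in auto)
  moreover have "t = l" if "t \<in> T" "\<forall>s\<in>T. s \<le> t" for t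
  proof -
    have "l \<in> T" using a2 by auto
    then have "l \<le> t" using that(2) by blast
    moreover have "t \<le> l" using that(1) a12 a2 by auto
    ultimately show ?thesis by simp
  qed
  ultimately have "\<not> ((\<forall>s\<in>T. s \<le> t) \<and> trho T t < t)" if "t \<in> T" for t
    using that by (metis less_irrefl)
  then show ?thesis unfolding tkappa_def by blast
qed

text \<open>This justifies the definite description: at dense points by uniqueness of the derivative
  within a nondegenerate interval, at \<open>a1\<close> because the value is a difference
  quotient.\<close>

lemma delta_deriv_T:
  assumes f: "has_delta_derivative T f D t" and t: "t \<in> T"
  shows "delta_deriv T f t = D"
  unfolding delta_deriv_def
proof (rule the_equality[where P = "\<lambda>D. has_delta_derivative T f D t", OF f])
  fix D' assume f': "has_delta_derivative T f D' t"
  have dense: "D' = D" if "tsigma T t = t" "t \<in> {u..v}" "u < v" "{u..v} \<subseteq> T" for u v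
    using vector_derivative_unique_within_closed_interval[of u v t f D' D]
      has_delta_derivative_right_dense[OF f that(1,4)] has_delta_derivative_right_dense[OF f' that(1,4)] that
    by (simp add: has_real_derivative_iff_has_vector_derivative)
  consider "t \<in> {0..<a1}" | "t = a1" | "t \<in> {a2..l}" using t by force
  then show "D' = D"
  proof cases
    case 1 then show ?thesis using dense[of 0 a1] tsigma_T by auto
  next
    case 2
    then show ?thesis
      using has_delta_derivative_scattered(1)[OF f t] has_delta_derivative_scattered(1)[OF f' t] tsigma_T(2) a12
      by simp
  next
    case 3 then show ?thesis using dense[of a2 l] tsigma_T a2 by auto
  qed
qed

lemma solves_SL_delta:
  assumes "solves_SL T q \<mu> y" and t: "t \<in> T"
  shows "has_delta_derivative T y (delta_deriv T y t) t"
    and "has_delta_derivative T (delta_deriv T y) ((q t - \<mu>) * y (tsigma T t)) t"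
proof -
  note S = assms(1)[unfolded solves_SL_def C2rd_def tkappa_T]
  show "has_delta_derivative T y (delta_deriv T y t) t"
    using S t delta_deriv_T by metis
  obtain D where D: "has_delta_derivative T (delta_deriv T y) D t" using S t by blast
  have "- delta_deriv T (delta_deriv T y) t + q t * y (tsigma T t) = \<mu> * y (tsigma T t)"
    using S t by blast
  then have "D = (q t - \<mu>) * y (tsigma T t)" unfolding delta_deriv_T[OF D t] by (simp add: algebra_simps)
  then show "has_delta_derivative T (delta_deriv T y) ((q t - \<mu>) * y (tsigma T t)) t" using D by simp
qed

text \<open>Source of \<open>left_val\<close> and \<open>left_der\<close>: at \<open>a1\<close> the
  shifted argument in the equation is \<open>a2\<close>, so the second jump involves the already
  shifted value \<open>y a2\<close>.\<close>

lemma solves_SL_jump: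
  assumes "solves_SL T q \<mu> y"
  shows "y a2 = y a1 + (a2 - a1) * delta_deriv T y a1"
    and "delta_deriv T y a2 = delta_deriv T y a1 + (a2 - a1) * ((q a1 - \<mu>) * y a2)"
proof -
  have t: "a1 \<in> T" "a1 < tsigma T a1" using a1 a12 tsigma_T(2) by auto
  show "y a2 = y a1 + (a2 - a1) * delta_deriv T y a1"
    "delta_deriv T y a2 = delta_deriv T y a1 + (a2 - a1) * ((q a1 - \<mu>) * y a2)"
    using has_delta_derivative_scattered(1)[OF solves_SL_delta(1)[OF assms t(1)] t]
      has_delta_derivative_scattered(1)[OF solves_SL_delta(2)[OF assms t(1)] t] tsigma_T(2) by auto
qed

lemma solves_SL_right_deriv:
  assumes "solves_SL T q \<mu> y" and t: "t \<in> {a2..l}"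
  shows "(y has_vector_derivative delta_deriv T y t) (at t within {a2..l})"
    and "(delta_deriv T y has_vector_derivative (q t - \<mu>) * y t) (at t within {a2..l})"
  using has_delta_derivative_right_dense[OF solves_SL_delta(1)[OF assms(1)], of t "{a2..l}"]
    has_delta_derivative_right_dense[OF solves_SL_delta(2)[OF assms(1)], of t "{a2..l}"]
    t tsigma_T(3)[OF t]
  by (auto simp: has_real_derivative_iff_has_vector_derivative)

lemma solves_SL_left_deriv:
  assumes y: "solves_SL T q \<mu> y" and q: "continuous_on T q" and t: "t \<in> {0..a1}"
  shows "(y has_vector_derivative delta_deriv T y t) (at t within {0..a1})"
    and "(delta_deriv T y has_vector_derivative (q t - \<mu>) * y t) (at t within {0..a1})"
proof -
  have dense: "(y has_vector_derivative delta_deriv T y t) (at t within {0..a1})"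
    "(delta_deriv T y has_vector_derivative (q t - \<mu>) * y t) (at t within {0..a1})" if t: "t \<in> {0..<a1}" for t
    using has_delta_derivative_right_dense[OF solves_SL_delta(1)[OF y], of t "{0..a1}"]
      has_delta_derivative_right_dense[OF solves_SL_delta(2)[OF y], of t "{0..a1}"]
      t tsigma_T(1)[OF t]
    by (auto simp: has_real_derivative_iff_has_vector_derivative)
  have end_cont: "continuous (at a1 within {0..a1}) y" "continuous (at a1 within {0..a1}) (delta_deriv T y)"
  proof -
    have t: "a1 \<in> T" "a1 < tsigma T a1" using a1 a12 tsigma_T(2) by auto
    show "continuous (at a1 within {0..a1}) y" "continuous (at a1 within {0..a1}) (delta_deriv T y)"
      using has_delta_derivative_scattered(2)[OF solves_SL_delta(1)[OF y t(1)] t]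
        has_delta_derivative_scattered(2)[OF solves_SL_delta(2)[OF y t(1)] t]
      by (auto intro: continuous_within_subset)
  qed
  have cont: "continuous_on {0..a1} y" "continuous_on {0..a1} (delta_deriv T y)"
    unfolding continuous_on_eq_continuous_within
    using end_cont dense by (metis atLeastAtMost_iff atLeastLessThan_iff has_vector_derivative_continuous less_le)+
  show "(y has_vector_derivative delta_deriv T y t) (at t within {0..a1})"
    by (rule has_vector_derivative_at_right_end[OF a1 cont dense(1) t])
  have "continuous_on {0..a1} (\<lambda>t. (q t - \<mu>) * y t)"
    by (intro continuous_intros cont continuous_on_subset[OF q]) auto
  from has_vector_derivative_at_right_end[OF a1 cont(2) this dense(2) t]
  show "(delta_deriv T y has_vector_derivative (q t - \<mu>) * y t) (at t within {0..a1})" .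
qed

lemma solves_SL_left_ode:
  assumes "solves_SL T q \<mu> y" "continuous_on T q"
  shows "ode_sol a1 (\<lambda>x. of_real (q x) - of_real \<mu>) (\<lambda>x. of_real (y x)) (\<lambda>x. of_real (delta_deriv T y x))"
  unfolding ode_sol_def
  using has_vector_derivative_complex_of_real[OF solves_SL_left_deriv(1)[OF assms]]
    has_vector_derivative_complex_of_real[OF solves_SL_left_deriv(2)[OF assms]]
  by simp

lemma solves_SL_right_ode:
  assumes "solves_SL T q \<mu> y"
  shows "ode_sol (l - a2) (\<lambda>x. of_real (q (l - x)) - of_real \<mu>)
           (\<lambda>x. of_real (y (l - x))) (\<lambda>x. - of_real (delta_deriv T y (l - x)))"
proof -
  have refl: "((\<lambda>x. complex_of_real (f (l - x))) has_vector_derivative - of_real f') (at x within {0..l - a2})"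
    if "(f has_vector_derivative f') (at (l - x) within {a2..l})" for f :: "real \<Rightarrow> real" and f' x
  proof -
    have "(f has_vector_derivative f') (at (l - x) within (\<lambda>x. l - x) ` {0..l - a2})"
      by (rule has_vector_derivative_within_subset[OF that]) auto
    moreover have "((\<lambda>x. l - x) has_vector_derivative - 1) (at x within {0..l - a2})"
      by (auto intro!: derivative_eq_intros)
    ultimately have "((f \<circ> (\<lambda>x. l - x)) has_vector_derivative (-1) *\<^sub>R f') (at x within {0..l - a2})"
      by (intro vector_diff_chain_within)
    from has_vector_derivative_complex_of_real[OF this] show ?thesis by (simp add: o_def)
  qed
  have "((\<lambda>x. complex_of_real (y (l - x))) has_vector_derivative - of_real (delta_deriv T y (l - x)))
        (at x within {0..l - a2})"
    and "((\<lambda>x. - complex_of_real (delta_deriv T y (l - x))) has_vector_derivative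
        (of_real (q (l - x)) - of_real \<mu>) * of_real (y (l - x))) (at x within {0..l - a2})"
    if "x \<in> {0..l - a2}" for x
    using refl[OF solves_SL_right_deriv(1)[OF assms], of x]
      has_vector_derivative_minus[OF refl[OF solves_SL_right_deriv(2)[OF assms], of x]] that
    by auto
  then show ?thesis unfolding ode_sol_def by blast
qed

text \<open>Zero data pass through the left interval, the jump and the right interval in turn. Hence
  an eigenfunction has \<open>y 0 \<noteq> 0\<close>.\<close>

lemma solves_SL_zero:
  assumes y: "solves_SL T q \<mu> y" and q: "continuous_on T q"
    and ini: "y 0 = 0" "delta_deriv T y 0 = 0" and t: "t \<in> T"
  shows "y t = 0"
proof -
  have null: "ode_sol a p (\<lambda>_. 0) (\<lambda>_. 0)" for a p by (simp add: ode_sol_def)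
  have left: "y x = 0" "delta_deriv T y x = 0" if "x \<in> {0..a1}" for x
    using sl_sol_unique[OF _ solves_SL_left_ode[OF y q] null _ _ that] ini
      continuous_on_subset[OF q, of "{0..a1}"] by auto
  have end0: "y a2 = 0" "delta_deriv T y a2 = 0"
    using solves_SL_jump[OF y] left[of a1] a1 by auto
  have right: "y (a2 + x) = 0" if x: "x \<in> {0..l - a2}" for x
  proof -
    \<comment> \<open>Reflecting the already reflected equation gives an initial value problem at
      \<open>a2\<close>.\<close>
    have ode: "ode_sol (l - a2) (\<lambda>x. of_real (q (a2 + x)) - of_real \<mu>)
        (\<lambda>x. of_real (y (a2 + x))) (\<lambda>x. of_real (delta_deriv T y (a2 + x)))"
      using ode_sol_reflect[OF solves_SL_right_ode[OF y]] by (simp add: algebra_simps)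
    have "continuous_on {0..l - a2} (\<lambda>x. q (a2 + x))"
      by (rule continuous_on_compose2[OF q]) (auto intro!: continuous_intros)
    from sl_sol_unique(1)[OF this ode null _ _ x] end0 show ?thesis by simp
  qed
  show ?thesis using left(1)[of t] right[of "t - a2"] t by auto
qed

end

text \<open>The jump is a composition of two shears, hence invertible, and a solution with a nonzero
  Wronskian cannot vanish together with its derivative.\<close>

lemma (in jump_problem) left_data_nonzero:
  assumes "left_val \<mu> = 0" shows "left_der \<mu> \<noteq> 0"
proof
  assume "left_der \<mu> = 0"
  then have 0: "Y' \<mu> a = 0" "Y \<mu> a = 0" using assms by (auto simp: left_der_def left_val_def)
  obtain S S' where S: "sl_family a q1 0 1 S S'" using sl_family_exists[OF less_imp_le[OF a_pos] q1] .
  show False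
    using ode_sol_wronskian[OF sl_familyD(1)[OF Y, of \<mu>] sl_familyD(1)[OF S, of \<mu>], of a]
      sl_familyD(2,3)[OF Y, of \<mu>] sl_familyD(2,3)[OF S, of \<mu>] 0 a_pos by simp
qed

section \<open>The eigenvalue problem on the time scale as a jump problem\<close>

locale gap_problem = two_intervals a1 a2 l +
  jump_problem a1 "a2 - a1" "q a1" h H q "\<lambda>x. q (l - x)" Y Y' Z Z'
  for a1 a2 l h H :: real and q :: "real \<Rightarrow> real" and Y Y' Z Z' +
  assumes q: "continuous_on T q" and len: "a1 + a2 = l"
begin

lemma solves_SL_left:
  assumes y: "solves_SL T q \<mu> y" and "delta_deriv T y 0 = h * y 0" and x: "x \<in> {0..a1}"
  shows "of_real (y x) = of_real (y 0) * Y (of_real \<mu>) x"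
    and "of_real (delta_deriv T y x) = of_real (y 0) * Y' (of_real \<mu>) x"
  using sl_sol_multiple[OF q1 Y solves_SL_left_ode[OF y q] _ x] assms(2) by auto

text \<open>The Wronskian with \<open>Z\<close> on the right interval is constant: at
  \<open>l\<close> it is the boundary expression up to sign, at \<open>a2\<close> it is computed
  from the left data through the jump.\<close>

lemma solves_SL_right_boundary:
  assumes y: "solves_SL T q \<mu> y" and ini: "delta_deriv T y 0 = h * y 0"
  shows "complex_of_real (delta_deriv T y l + H * y l) = of_real (y 0) * char_fun (of_real \<mu>)"
proof -
  let ?\<mu> = "complex_of_real \<mu>"
  have len': "l - a2 = a1" "l - a1 = a2" using len by auto
  have a1': "a1 \<in> {0..a1}" using a1 by auto
  have "- complex_of_real (delta_deriv T y a2) * Z ?\<mu> a1 - of_real (y a2) * Z' ?\<mu> a1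
      = - of_real (delta_deriv T y l) * 1 - of_real (y l) * of_real H"
    using ode_sol_wronskian[OF solves_SL_right_ode[OF y, unfolded len'] sl_familyD(1)[OF Z] a1']
      sl_familyD(2,3)[OF Z, of ?\<mu>] len' by simp
  then have "complex_of_real (delta_deriv T y l + H * y l)
      = of_real (delta_deriv T y a2) * Z ?\<mu> a1 + of_real (y a2) * Z' ?\<mu> a1"
    by (simp add: algebra_simps)
  also have val: "complex_of_real (y a2) = of_real (y 0) * left_val ?\<mu>"
    unfolding solves_SL_jump(1)[OF y] left_val_def
    using solves_SL_left[OF y ini a1'] by (simp add: algebra_simps)
  also have "complex_of_real (delta_deriv T y a2) = of_real (y 0) * left_der ?\<mu>"
    unfolding solves_SL_jump(2)[OF y] left_der_def
    using solves_SL_left[OF y ini a1'] val by (simp add: algebra_simps)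
  finally show ?thesis by (simp add: char_fun_def algebra_simps)
qed

lemma eigenvalue_iff_char_fun:
  assumes \<phi>: "solves_SL T q \<mu> \<phi>" "\<phi> 0 = 1" "delta_deriv T \<phi> 0 = h"
  shows "is_eigenvalue T l q h H \<mu> \<longleftrightarrow> char_fun (of_real \<mu>) = 0"
proof
  assume "is_eigenvalue T l q h H \<mu>"
  then obtain y t where y: "solves_SL T q \<mu> y" "delta_deriv T y 0 = h * y 0"
      "delta_deriv T y l + H * y l = 0" "t \<in> T" "y t \<noteq> 0"
    unfolding is_eigenvalue_def right_minus_eq by blast
  have "y 0 \<noteq> 0" using solves_SL_zero[OF y(1) q _ _ y(4)] y(2,5) by auto
  then show "char_fun (of_real \<mu>) = 0"
    using solves_SL_right_boundary[OF y(1,2)] y(3) by simp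
next
  assume "char_fun (of_real \<mu>) = 0"
  then have "complex_of_real (delta_deriv T \<phi> l + H * \<phi> l) = 0"
    using solves_SL_right_boundary[OF \<phi>(1)] \<phi>(2,3) by simp
  then have "delta_deriv T \<phi> l + H * \<phi> l = 0" by (simp only: of_real_eq_0_iff)
  moreover have "0 \<in> T" using a1 by auto
  ultimately show "is_eigenvalue T l q h H \<mu>"
    unfolding is_eigenvalue_def using \<phi> by (intro exI[of _ \<phi>] conjI bexI[of _ 0]) simp_all
qed

end

theorem theorem1:
  fixes a1 a2 l h H :: real and q qt :: "real \<Rightarrow> real"
    and \<phi> \<phi>t :: "real \<Rightarrow> real \<Rightarrow> real"
  assumes "0 < a1" "a1 < a2" "a2 < l"
    and "continuous_on ({0..a1} \<union> {a2..l}) q"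
    and "continuous_on ({0..a1} \<union> {a2..l}) qt"
    and "\<And>\<mu>. solves_SL ({0..a1} \<union> {a2..l}) q \<mu> (\<lambda>t. \<phi> t \<mu>)
               \<and> \<phi> 0 \<mu> = 1 \<and> delta_deriv ({0..a1} \<union> {a2..l}) (\<lambda>t. \<phi> t \<mu>) 0 = h"
    and "\<And>\<mu>. solves_SL ({0..a1} \<union> {a2..l}) qt \<mu> (\<lambda>t. \<phi>t t \<mu>)
               \<and> \<phi>t 0 \<mu> = 1 \<and> delta_deriv ({0..a1} \<union> {a2..l}) (\<lambda>t. \<phi>t t \<mu>) 0 = h"
    and "{\<mu>. is_eigenvalue ({0..a1} \<union> {a2..l}) l q h H \<mu>}
         = {\<mu>. is_eigenvalue ({0..a1} \<union> {a2..l}) l qt h H \<mu>}"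
    and "a1 + a2 = l"
    and "\<And>\<mu>. is_eigenvalue ({0..a1} \<union> {a2..l}) l q h H \<mu> \<Longrightarrow>
           delta_deriv ({0..a1} \<union> {a2..l}) (\<lambda>t. \<phi> t \<mu>) a1 * \<phi>t a1 \<mu>
           = delta_deriv ({0..a1} \<union> {a2..l}) (\<lambda>t. \<phi>t t \<mu>) a1 * \<phi> a1 \<mu>"
  shows "\<forall>t\<in>{0..a1} \<union> {a2..l}. q t = qt t"
proof -
  let ?T = "{0..a1} \<union> {a2..l}"
  have a: "0 \<le> a1" "a1 \<in> {0..a1}" using \<open>0 < a1\<close> by auto
  have left: "continuous_on {0..a1} p" and right: "continuous_on {0..a1} (\<lambda>x. p (l - x))"
    if "continuous_on ?T p" for p :: "real \<Rightarrow> real"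
    using continuous_on_subset[OF that, of "{0..a1}"] assms(9)
    by (auto intro!: continuous_on_compose2[OF that] continuous_intros)
  obtain Y Y' where Y: "sl_family a1 q 1 (of_real h) Y Y'"
    using sl_family_exists[OF a(1) left[OF assms(4)]] .
  obtain Yt Yt' where Yt: "sl_family a1 qt 1 (of_real h) Yt Yt'"
    using sl_family_exists[OF a(1) left[OF assms(5)]] .
  obtain Z Z' where Z: "sl_family a1 (\<lambda>x. q (l - x)) 1 (of_real H) Z Z'"
    using sl_family_exists[OF a(1) right[OF assms(4)]] .
  obtain Zt Zt' where Zt: "sl_family a1 (\<lambda>x. qt (l - x)) 1 (of_real H) Zt Zt'"
    using sl_family_exists[OF a(1) right[OF assms(5)]] .
  interpret L: gap_problem a1 a2 l h H q Y Y' Z Z'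
    using assms left right Y Z by unfold_locales auto
  interpret Lt: gap_problem a1 a2 l h H qt Yt Yt' Zt Zt'
    using assms left right Yt Zt by unfold_locales auto
  have eig: "is_eigenvalue ?T l q h H \<mu> \<longleftrightarrow> L.char_fun (of_real \<mu>) = 0" for \<mu>
    using L.eigenvalue_iff_char_fun assms(6) by blast
  have eigt: "is_eigenvalue ?T l qt h H \<mu> \<longleftrightarrow> Lt.char_fun (of_real \<mu>) = 0" for \<mu>
    using Lt.eigenvalue_iff_char_fun assms(7) by blast
  have q_left: "q x = qt x" if x: "x \<in> {0..a1}" for x
  proof (rule L.potential_unique_if_equal_on_spectrum[OF left left Y Yt _ x])
    fix \<mu> :: real assume "L.char_fun (of_real \<mu>) = 0"
    then have "delta_deriv ?T (\<lambda>t. \<phi> t \<mu>) a1 * \<phi>t a1 \<mu> = delta_deriv ?T (\<lambda>t. \<phi>t t \<mu>) a1 * \<phi> a1 \<mu>"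
      using assms(10) eig by blast
    then have "complex_of_real (delta_deriv ?T (\<lambda>t. \<phi> t \<mu>) a1) * of_real (\<phi>t a1 \<mu>)
        = of_real (delta_deriv ?T (\<lambda>t. \<phi>t t \<mu>) a1) * of_real (\<phi> a1 \<mu>)"
      by (metis of_real_mult)
    then show "Y' (of_real \<mu>) a1 * Yt (of_real \<mu>) a1 = Yt' (of_real \<mu>) a1 * Y (of_real \<mu>) a1"
      using L.solves_SL_left[of \<mu> "\<lambda>t. \<phi> t \<mu>" a1] Lt.solves_SL_left[of \<mu> "\<lambda>t. \<phi>t t \<mu>" a1]
        assms(6,7)[of \<mu>] a by simp
  qed (fact assms)+
  \<comment> \<open>Equal potentials on the left make the left data agree at every complex
    parameter, so both problems reach \<open>a2\<close> with the same data.\<close>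
  have YYt: "Y \<mu> a1 = Yt \<mu> a1" "Y' \<mu> a1 = Yt' \<mu> a1" for \<mu>
    using sl_sol_unique[OF left[OF assms(4)] sl_familyD(1)[OF Y, of \<mu>] ode_sol_cong[OF sl_familyD(1)[OF Yt, of \<mu>]] _ _ a(2)]
      sl_familyD(2,3)[OF Y] sl_familyD(2,3)[OF Yt] q_left by simp_all
  have q_right: "q (l - x) = qt (l - x)" if x: "x \<in> {0..a1}" for x
  proof (rule L.potential_unique_if_equal_on_spectrum[OF right right Z Zt _ x])
    fix \<mu> :: real
    let ?A = "L.left_val (of_real \<mu>)" and ?B = "L.left_der (of_real \<mu>)"
    assume z: "L.char_fun (of_real \<mu>) = 0"
    then have "Lt.char_fun (of_real \<mu>) = 0" using eig eigt assms(8) by blast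
    moreover have A: "Lt.left_val (of_real \<mu>) = ?A" "Lt.left_der (of_real \<mu>) = ?B"
      unfolding L.left_val_def Lt.left_val_def L.left_der_def Lt.left_der_def
      by (simp_all add: YYt q_left[OF a(2)])
    ultimately have 1: "?B * Z (of_real \<mu>) a1 = - (?A * Z' (of_real \<mu>) a1)"
      and 2: "?B * Zt (of_real \<mu>) a1 = - (?A * Zt' (of_real \<mu>) a1)"
      using z by (auto simp: L.char_fun_def Lt.char_fun_def eq_neg_iff_add_eq_0)
    \<comment> \<open>At an eigenvalue the same nonzero pair \<open>(?B, ?A)\<close> annihilates the
      end data of \<open>Z\<close> and of \<open>Zt\<close>, so their determinant vanishes.\<close>
    let ?W = "Z' (of_real \<mu>) a1 * Zt (of_real \<mu>) a1 - Zt' (of_real \<mu>) a1 * Z (of_real \<mu>) a1"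
    have "?A * ?W = 0" "?B * ?W = 0" using 1 2 by algebra+
    then have "?W = 0" using L.left_data_nonzero[of "of_real \<mu>"] by auto
    then show "Z' (of_real \<mu>) a1 * Zt (of_real \<mu>) a1 = Zt' (of_real \<mu>) a1 * Z (of_real \<mu>) a1" by simp
  qed (fact assms)+
  show ?thesis
  proof
    fix t assume "t \<in> ?T"
    then show "q t = qt t"
      using q_left[of t] q_right[of "l - t"] assms(9) by auto
  qed
qed

end
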